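(* There are no integers $n\ge 0$ and $k\ge 2$ satisfying the Diophantine equation $$L_n^{(k)}=|\mathrm{Disc}(g_k)|,$$ where $g_k(X)=X^k-X^{k-1}-\cdots-X-1$.
   Context: For an integer $k\ge 2$, the $k$-generalized Lucas sequence $\{L_n^{(k)}\}_{n\ge 2-k}$ is defined by $L_{2-k}^{(k)}=\cdots=L_{-1}^{(k)}=0$, $L_0^{(k)}=2$, $L_1^{(k)}=1$, and $L_n^{(k)}=L_{n-1}^{(k)}+L_{n-2}^{(k)}+\cdots+L_{n-k}^{(k)}$ for all $n\ge 2$. The polynomial $g_k(X)=X^k-X^{k-1}-\cdots-X-1$ is its characteristic polynomial, and $\mathrm{Disc}(g_k)$ denotes its discriminant; explicitly $\mathrm{Disc}(g_k)=(-1)^{\binom{k+1}{2}-1}\dfrac{2^{k+1}k^k-(k+1)^{k+1}}{(k-1)^2}$. *)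

theory Defs
  imports Complex_Main "Subresultants.Resultant_Prelim"
begin

(* Indexed by all integers; the k-generalized Lucas sequence is the restriction to n \<ge> 2 - k.
   The recurrence for n \<ge> 2 only refers to indices \<ge> 2 - k, so the value 0 below 2 - k
   is never used. *)
function gen_lucas :: "nat \<Rightarrow> int \<Rightarrow> int" where
  "gen_lucas k n =
     (if n < 0 then 0
      else if n = 0 then 2
      else if n = 1 then 1
      else (\<Sum>i\<in>{1..k}. gen_lucas k (n - int i)))"
  by pat_completeness auto
termination
  by (relation "measure (\<lambda>(k, n). nat n)") auto

declare gen_lucas.simps [simp del]

definition char_poly_g :: "nat \<Rightarrow> int poly" where
  "char_poly_g k = monom 1 k - (\<Sum>i<k. monom 1 i)"

(* Disc(p) = (-1)^(d(d-1)/2) * Res(p, p') / a_d, where d is the degree and a_d the leading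
   coefficient of p. The division is exact, since the first column of the Sylvester matrix
   of p and p' is divisible by a_d. *)
definition discriminant :: "int poly \<Rightarrow> int" where
  "discriminant p =
     ((-1) ^ (degree p * (degree p - 1) div 2) * resultant p (pderiv p)) div lead_coeff p"

end

theory Submission
  imports Defs "HOL-Computational_Algebra.Primes" "HOL-Analysis.Harmonic_Numbers"
    "Jordan_Normal_Form.Char_Poly"
begin

text \<open>
  The generalized Lucas numbers satisfy \<open>L (n + 1) = 2 L n - L (n - k)\<close>. Hence \<open>L n\<close> equals
  \<open>3 * 2 ^ (n - 2)\<close> up to a relative error of about \<open>n / 2 ^ (k + 1)\<close>, and modulo high powers of 2
  the term of index \<open>q (k + 1) + m\<close> is \<open>2 ^ (m - 2)\<close> times an explicit binomial expression in \<open>q\<close>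
  and \<open>m\<close>. The discriminant is odd for even \<open>k\<close> and divisible by \<open>2 ^ (k - 1)\<close> for odd \<open>k\<close>; so a
  solution has an index \<open>n = (s + 1) (k + 1) + j\<close> with \<open>j\<close> of size \<open>O(log k)\<close>, and comparing
  sizes forces \<open>k = 2 ^ s + r\<close> with \<open>r = O(s)\<close>. What remains is that \<open>(k / 2 ^ s) ^ k\<close> agrees, up
  to a relative error of about \<open>2 ^ (- k)\<close>, with \<open>3 * 2 ^ t * ((k - 1) / 2 ^ s) ^ 2\<close>, a rational
  number whose denominator is a small power of 2. For \<open>s \<ge> 29\<close> this contradicts the quality of the
  diagonal Pade approximants of \<open>(1 + z) ^ k\<close> at \<open>z = r / 2 ^ s\<close>, which have integer coefficients;
  for smaller \<open>s\<close> it is refuted by comparing logarithms numerically.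
\<close>

section \<open>Resultants and the discriminant\<close>

text \<open>Sizes alone cannot exclude a solution: they place \<open>n\<close> near
  \<open>k * (log2 k + 1)\<close> for every \<open>k\<close>, and what remains is a linear form in
  logarithms whose arguments grow with \<open>k\<close>. The 2-adic information makes it tractable.
  By size, \<open>n / (k + 1)\<close> is about \<open>log2 k + 1\<close>; by divisibility,
  \<open>n\<close> is within \<open>O(log k)\<close> of a multiple of \<open>k + 1\<close>. Together
  they put \<open>log2 k\<close> within \<open>O(log k / k)\<close> of an integer \<open>s\<close>,
  which is where \<open>k = 2 ^ s + r\<close> comes from. Now \<open>z = r / 2 ^ s\<close> is tiny,
  and the degree needed is only about \<open>s * 2 ^ (s / 2)\<close>, so that the cost
  \<open>2 ^ (s * d)\<close> of clearing denominators is far smaller than the accuracy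
  \<open>2 ^ k\<close> with which the two sides agree. Nonvanishing, the usual difficulty in such an
  argument, is settled by positivity: for \<open>r >= 1\<close> the Pade remainder is a power series
  in \<open>z\<close> with nonnegative coefficients and is bounded below as well as above. The
  offsets \<open>r <= 0\<close> lie outside this scheme, but size estimates leave only 0, -1 and
  -2.\<close>

lemma poly_eq_reversed_sum:
  fixes r :: "'a::comm_ring_1 poly"
  assumes "degree r < N"
  shows "(\<Sum>j<N. coeff r (N - 1 - j) * x ^ (N - 1 - j)) = poly r x"
proof -
  have "(\<Sum>j<N. coeff r (N - 1 - j) * x ^ (N - 1 - j)) = (\<Sum>j<N. coeff r j * x ^ j)"
    using sum.nat_diff_reindex[of "\<lambda>j. coeff r j * x ^ j" N] by simp
  also have "\<dots> = poly r x"
    unfolding poly_altdef using assms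
    by (intro sum.mono_neutral_right) (auto simp: coeff_eq_0 not_le)
  finally show ?thesis .
qed

text \<open>A kernel vector of the transpose lists the coefficients of a nonzero polynomial of
  degree below \<open>m\<close> with \<open>m\<close> distinct roots. Nonvanishing suffices, since
  this determinant gets cancelled from both sides of the resultant identity.\<close>

lemma det_vandermonde_nonzero:
  fixes \<rho> :: "nat \<Rightarrow> 'a::field"
  assumes inj: "inj_on \<rho> {..<m}"
  shows "det (Matrix.mat m m (\<lambda>(j,i). \<rho> i ^ (m - 1 - j))) \<noteq> 0" (is "det ?V \<noteq> 0")
proof
  assume "det ?V = 0"
  then have "det (transpose_mat ?V) = 0"
    by (subst det_transpose) auto
  then obtain v where v: "v \<in> carrier_vec m" "v \<noteq> 0\<^sub>v m" "transpose_mat ?V *\<^sub>v v = 0\<^sub>v m"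
    using det_0_iff_vec_prod_zero_field[of "transpose_mat ?V" m] by auto
  define f where "f = (\<Sum>j<m. monom (vec_index v j) (m - 1 - j))"
  have coeff_f: "coeff f (m - 1 - j) = vec_index v j" if "j < m" for j
  proof -
    have "coeff f (m - 1 - j) = (\<Sum>i<m. if i = j then vec_index v i else 0)"
      unfolding f_def coeff_sum using that by (intro sum.cong) auto
    then show ?thesis using that by simp
  qed
  have "f \<noteq> 0"
  proof
    assume "f = 0"
    then have "v = 0\<^sub>v m" using v(1) coeff_f by (intro eq_vecI) auto
    with v(2) show False by simp
  qed
  have root: "poly f (\<rho> i) = 0" if "i < m" for i
  proof -
    have "vec_index (transpose_mat ?V *\<^sub>v v) i = (\<Sum>j<m. \<rho> i ^ (m - 1 - j) * vec_index v j)"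
      using that v(1) by (simp add: scalar_prod_def atLeast0LessThan)
    then have "(\<Sum>j<m. \<rho> i ^ (m - 1 - j) * vec_index v j) = 0" unfolding v(3) using that by simp
    then show ?thesis by (simp add: f_def poly_sum poly_monom mult.commute)
  qed
  have m: "m > 0" using v by (cases m) auto
  have "degree f \<le> m - 1" unfolding f_def
    by (intro degree_sum_le) (auto intro: order.trans[OF degree_monom_le])
  have "m = card (\<rho> ` {..<m})" using inj by (simp add: card_image)
  also have "\<dots> \<le> card {x. poly f x = 0}"
    using root \<open>f \<noteq> 0\<close> by (intro card_mono) (auto simp: poly_roots_finite)
  also have "\<dots> \<le> degree f" using \<open>f \<noteq> 0\<close> by (rule card_poly_roots_bound)
  finally show False using \<open>degree f \<le> m - 1\<close> m by simp
qed

text \<open>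
  The Sylvester matrix times the block matrix \<open>W\<close> built from the identity and the powers of the
  roots is block triangular, because a row of the Sylvester matrix applied to the powers of \<open>x\<close>
  evaluates \<open>x ^ i * p\<close> or \<open>x ^ i * q\<close> at \<open>x\<close>.
\<close>

lemma resultant_prod_linear:
  fixes \<rho> :: "nat \<Rightarrow> 'a::field" and q :: "'a poly"
  assumes inj: "inj_on \<rho> {..<m}"
  shows "resultant (\<Prod>i<m. [:- \<rho> i, 1:]) q = (\<Prod>i<m. poly q (\<rho> i))"
proof -
  define p where "p = (\<Prod>i<m. [:- \<rho> i, 1:])"
  define n where "n = degree q"
  define N where "N = m + n"
  have deg_p: "degree p = m"
    unfolding p_def by (subst degree_prod_eq_sum_degree) auto
  have monic: "coeff p m = 1"
    using lead_coeff_prod[of "\<lambda>i. [:- \<rho> i, 1:]" "{..<m}"] deg_p by (simp add: p_def)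
  have root: "poly p (\<rho> i) = 0" if "i < m" for i
    using that by (auto simp: p_def poly_prod)
  define R where "R i = (if i < n then monom 1 (n - 1 - i) * p else monom 1 (N - 1 - i) * q)" for i
  define S where "S = sylvester_mat p q"
  have S: "S \<in> carrier_mat N N"
    unfolding S_def N_def n_def deg_p[symmetric] by (rule sylvester_carrier_mat)
  have deg_R: "degree (R i) < N" if "i < N" for i
  proof (cases "i < n")
    case True
    have "degree (R i) \<le> (n - 1 - i) + m"
      unfolding R_def using True deg_p
      by (auto intro: order.trans[OF degree_mult_le] simp: degree_monom_eq)
    then show ?thesis using True by (simp add: N_def)
  next
    case False
    have "degree (R i) \<le> (N - 1 - i) + n"
      unfolding R_def using False
      by (auto intro: order.trans[OF degree_mult_le] simp: degree_monom_eq n_def)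
    then show ?thesis using False that by (simp add: N_def)
  qed
  have S_index: "S $$ (i, j) = coeff (R i) (N - 1 - j)" if "i < N" "j < N" for i j
    using that sylvester_index_mat2[of i p q j]
    by (auto simp: S_def R_def N_def n_def deg_p coeff_monom_mult Suc_diff_Suc)
  define V where "V = Matrix.mat m m (\<lambda>(j,i). \<rho> i ^ (m - 1 - j))"
  define B where "B = Matrix.mat n m (\<lambda>(j,i). \<rho> i ^ (N - 1 - j))"
  define W where "W = four_block_mat (1\<^sub>m n) B (0\<^sub>m m n) V"
  have W: "W \<in> carrier_mat N N" unfolding W_def N_def V_def B_def by auto
  have det_W: "det W = det V"
    unfolding W_def
    by (subst det_four_block_mat_lower_left_zero[of _ n _ m]) (auto simp: V_def B_def)
  define T where "T = Matrix.mat n n (\<lambda>(i,j). S $$ (i, j))"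
  define C where "C = Matrix.mat m n (\<lambda>(i,j). S $$ (i + n, j))"
  define Q where "Q = Matrix.mat m m (\<lambda>(i,j). if i = j then poly q (\<rho> i) else 0)"
  have Q: "Q \<in> carrier_mat m m" and V: "V \<in> carrier_mat m m" by (auto simp: Q_def V_def)
  have VQ: "(V * Q) $$ (i, j) = \<rho> j ^ (m - 1 - i) * poly q (\<rho> j)" if "i < m" "j < m" for i j
  proof -
    have "(V * Q) $$ (i, j) = (\<Sum>l<m. \<rho> l ^ (m - 1 - i) * (if l = j then poly q (\<rho> l) else 0))"
      using that by (simp add: V_def Q_def scalar_prod_def atLeast0LessThan)
    also have "\<dots> = (\<Sum>l<m. if l = j then \<rho> l ^ (m - 1 - i) * poly q (\<rho> l) else 0)"
      by (intro sum.cong) auto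
    finally show ?thesis using that by simp
  qed
  have W_index: "W $$ (l, j) = (if j < n then if l = j then 1 else 0 else \<rho> (j - n) ^ (N - 1 - l))"
    if "l < N" "j < N" for l j
    using that by (auto simp: W_def V_def B_def N_def)
  have "S * W = four_block_mat T (0\<^sub>m n m) C (V * Q)"
  proof (rule eq_matI)
    fix i j
    assume "i < dim_row (four_block_mat T (0\<^sub>m n m) C (V * Q))"
      and "j < dim_col (four_block_mat T (0\<^sub>m n m) C (V * Q))"
    then have ij: "i < N" "j < N" using Q V by (auto simp: N_def T_def)
    have SW: "(S * W) $$ (i, j) = (\<Sum>l<N. S $$ (i, l) * W $$ (l, j))"
      using ij S W by (auto simp: scalar_prod_def atLeast0LessThan)
    show "(S * W) $$ (i, j) = four_block_mat T (0\<^sub>m n m) C (V * Q) $$ (i, j)"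
    proof (cases "j < n")
      case True
      have "(S * W) $$ (i, j) = (\<Sum>l<N. if l = j then S $$ (i, l) else 0)"
        unfolding SW using ij True by (intro sum.cong) (auto simp: W_index)
      then have "(S * W) $$ (i, j) = S $$ (i, j)" using ij by simp
      then show ?thesis using ij True Q V by (auto simp: T_def C_def N_def)
    next
      case False
      have "(S * W) $$ (i, j)
          = (\<Sum>l<N. coeff (R i) (N - 1 - l) * \<rho> (j - n) ^ (N - 1 - l))"
        unfolding SW using ij False by (intro sum.cong) (auto simp: W_index S_index)
      also have "\<dots> = poly (R i) (\<rho> (j - n))"
        using deg_R[OF ij(1)] by (rule poly_eq_reversed_sum)
      finally have *: "(S * W) $$ (i, j) = poly (R i) (\<rho> (j - n))" .
      have jn: "j - n < m" using ij False by (auto simp: N_def)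
      show ?thesis
      proof (cases "i < n")
        case True
        then show ?thesis using * False ij Q V jn root[OF jn]
          by (auto simp: R_def N_def T_def)
      next
        case i: False
        have "i - n < m" using i ij by (auto simp: N_def)
        then show ?thesis using * False ij Q V jn i VQ[OF \<open>i - n < m\<close> jn]
          by (auto simp: R_def N_def T_def poly_monom)
      qed
    qed
  qed (use S W Q V in \<open>auto simp: T_def N_def\<close>)
  then have "det (S * W) = det T * det (V * Q)"
    by (simp, subst det_four_block_mat_upper_right_zero[of _ n _ m])
      (use Q V in \<open>auto simp: T_def C_def\<close>)
  moreover have "det (S * W) = det S * det V" using det_mult[OF S W] det_W by simp
  moreover have "det (V * Q) = det V * det Q" using det_mult[OF V Q] .
  \<comment> \<open>The rows of this block are shifted coefficient rows of the monic polynomial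
    \<open>p\<close>, so the block is unitriangular.\<close>
  moreover have "det T = 1"
  proof -
    have "det T = prod_list (diag_mat T)"
      by (rule det_upper_triangular[of _ n])
        (auto simp: T_def S_index N_def R_def coeff_monom_mult deg_p upper_triangular_def intro!: coeff_eq_0)
    also have "\<dots> = 1"
      unfolding prod_list_diag_prod
      by (auto intro!: prod.neutral simp: T_def S_index N_def R_def coeff_monom_mult monic)
    finally show ?thesis .
  qed
  moreover have "det Q = (\<Prod>i<m. poly q (\<rho> i))"
  proof -
    have "det Q = prod_list (diag_mat Q)"
      by (rule det_upper_triangular[of _ m]) (auto simp: Q_def)
    also have "\<dots> = (\<Prod>i<m. poly q (\<rho> i))"
      unfolding prod_list_diag_prod by (auto simp: Q_def atLeast0LessThan)
    finally show ?thesis .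
  qed
  moreover have "det V \<noteq> 0" unfolding V_def using inj by (rule det_vandermonde_nonzero)
  ultimately show ?thesis by (simp add: resultant_def S_def p_def)
qed

section \<open>The discriminant of the characteristic polynomial\<close>

lemma char_poly_g_props:
  assumes "k \<ge> 1"
  shows "degree (char_poly_g k) = k" "lead_coeff (char_poly_g k) = 1"
    "[:-1, 1:] * char_poly_g k = monom 1 (k + 1) - smult 2 (monom 1 k) + 1"
proof -
  have coeff: "coeff (char_poly_g k) n = (if n = k then 1 else if n < k then -1 else 0)" for n
  proof -
    have "(\<Sum>i<k. coeff (monom (1::int) i) n) = (\<Sum>i<k. if i = n then 1 else 0)"
      by (intro sum.cong) auto
    then show ?thesis by (auto simp: char_poly_g_def coeff_sum)
  qed
  show deg: "degree (char_poly_g k) = k"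
    by (rule antisym) (auto intro!: degree_le le_degree simp: coeff)
  show "lead_coeff (char_poly_g k) = 1" by (simp add: deg coeff)
  show "[:-1, 1:] * char_poly_g k = monom 1 (k + 1) - smult 2 (monom 1 k) + 1"
  proof (rule poly_eqI)
    fix n
    show "coeff ([:-1, 1:] * char_poly_g k) n = coeff (monom 1 (k + 1) - smult 2 (monom 1 k) + 1) n"
      using assms by (cases n) (auto simp: coeff)
  qed
qed

text \<open>The absolute discriminant times \<open>(k - 1) ^ 2\<close>; keeping the product avoids
  an integer division.\<close>

definition disc_num :: "nat \<Rightarrow> int" where
  "disc_num k = 2 ^ (k + 1) * int k ^ k - (int k + 1) ^ (k + 1)"

text \<open>This is \<open>(1 + 1 / k) ^ k <= exp 1 <= 3\<close>. It shows that the second term of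
  \<open>disc_num\<close> is negligible, and later yields a weak Stirling bound.\<close>

lemma Suc_power_Suc_le:
  assumes "k \<ge> 1"
  shows "(k + 1) ^ (k + 1) \<le> 3 * (k + 1) * (k ^ k :: nat)"
proof -
  have k: "real k > 0" using assms by simp
  have "(1 + 1 / real k) ^ k \<le> exp (1 / real k) ^ k"
    by (intro power_mono) (auto simp: exp_ge_add_one_self)
  also have "\<dots> = exp 1" using k by (simp flip: exp_of_nat_mult)
  also have "\<dots> \<le> 3" by (rule exp_le)
  finally have "(1 + 1 / real k) ^ k \<le> 3" .
  have "real ((k + 1) ^ (k + 1)) = (real k + 1) * (real k ^ k * (1 + 1 / real k) ^ k)"
    using k by (simp add: power_mult_distrib[symmetric] distrib_left distrib_right add.commute)
  also have "\<dots> \<le> (real k + 1) * (real k ^ k * 3)"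
    using k \<open>(1 + 1 / real k) ^ k \<le> 3\<close> by (intro mult_left_mono) auto
  also have "\<dots> = real (3 * (k + 1) * k ^ k)" by (simp add: algebra_simps)
  finally show ?thesis by (simp only: of_nat_le_iff)
qed

lemma disc_num_pos:
  assumes "k \<ge> 2"
  shows "disc_num k > 0"
proof -
  have "(k + 1) ^ (k + 1) < (2::nat) ^ (k + 1) * k ^ k"
  proof (cases "k = 2")
    case False
    have "3 * (k + 1) < (2::nat) ^ (k + 1)" if "k \<ge> 3"
      using that by (induction k rule: dec_induct) auto
    moreover have "k ^ k > 0" using assms by simp
    ultimately have "3 * (k + 1) * k ^ k < 2 ^ (k + 1) * k ^ k" using False assms by simp
    moreover have "(k + 1) ^ (k + 1) \<le> 3 * (k + 1) * k ^ k"
      using assms by (intro Suc_power_Suc_le) simp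
    ultimately show ?thesis by linarith
  qed (simp add: eval_nat_numeral)
  then have "int ((k + 1) ^ (k + 1)) < int (2 ^ (k + 1) * k ^ k)" by (simp only: of_nat_less_iff)
  then show ?thesis by (simp add: disc_num_def algebra_simps)
qed

lemma prod_list_eq_prod_nth: "prod_list (map f xs) = (\<Prod>i<length xs. f (xs ! i))"
  by (induction xs rule: rev_induct) (auto simp: nth_append)

text \<open>Multiplication by \<open>X - 1\<close> telescopes \<open>g\<close> to the trinomial
  \<open>h\<close>, whose derivative factors. At a root \<open>x\<close> of \<open>g\<close> this
  gives \<open>(x - 1) * g'(x) = x ^ (k - 1) * ((k + 1) * x - 2 * k)\<close>. Over all roots, the
  three elementary factors multiply, up to sign, to values of \<open>g\<close> at 1, at 0 and at
  \<open>c = 2 * k / (k + 1)\<close>. A multiple root could only be 0 or \<open>c\<close>; the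
  latter is excluded because \<open>disc_num k\<close> is positive.\<close>

lemma abs_discriminant_char_poly_g:
  assumes k: "k \<ge> 2"
  shows "\<bar>discriminant (char_poly_g k)\<bar> * (int k - 1)\<^sup>2 = disc_num k"
proof -
  define g where "g = char_poly_g k"
  define P where "P = (of_int_poly g :: complex poly)"
  have deg: "degree g = k" and lc: "lead_coeff g = 1"
    using char_poly_g_props[of k] k by (auto simp: g_def)
  have degP: "degree P = k" and lcP: "lead_coeff P = 1" using deg lc by (auto simp: P_def)
  define h where "h = monom 1 (k + 1) - smult 2 (monom 1 k) + (1 :: complex poly)"
  have "of_int_poly ([:-1, 1:] * g) = (h :: complex poly)"
    using char_poly_g_props(3)[of k] k
    by (simp add: g_def h_def hom_distribs)
  then have h: "[:-1, 1:] * P = h" by (simp add: P_def hom_distribs)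
  have poly_h: "poly h x = x ^ (k + 1) - 2 * x ^ k + 1" for x
    by (simp add: h_def poly_monom)
  have hP: "(x - 1) * poly P x = x ^ (k + 1) - 2 * x ^ k + 1" for x
    unfolding poly_h[symmetric] h[symmetric] by (simp add: algebra_simps)
  have deriv_h: "poly (pderiv h) x = x ^ (k - 1) * ((of_nat k + 1) * x - 2 * of_nat k)" for x
    using k by (cases k) (auto simp: h_def pderiv_add pderiv_diff pderiv_smult pderiv_monom poly_monom algebra_simps)
  have deriv: "(x - 1) * poly (pderiv P) x = x ^ (k - 1) * ((of_nat k + 1) * x - 2 * of_nat k)"
    if "poly P x = 0" for x
    using that deriv_h[of x] unfolding h[symmetric] pderiv_mult
    by (simp add: pderiv_pCons algebra_simps)
  define c where "c = 2 * of_nat k / (of_nat k + 1 :: complex)"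
  have k1: "(of_nat k + 1 :: complex) \<noteq> 0" by (metis of_nat_Suc of_nat_eq_0_iff nat.distinct(1) add.commute)
  have c1: "(c - 1) * (of_nat k + 1) = of_nat k - 1" using k1 by (simp add: c_def field_simps)
  have Pc: "(of_nat k - 1) * (of_nat k + 1) ^ k * poly P c = - of_int (disc_num k)"
  proof -
    have ck: "c ^ k * (of_nat k + 1) ^ k = 2 ^ k * of_nat k ^ k"
      using k1 by (simp add: c_def power_divide power_mult_distrib)
    have ck1: "(c - 2) * (of_nat k + 1) = -2" using k1 by (simp add: c_def field_simps)
    have "(of_nat k - 1) * (of_nat k + 1) ^ k * poly P c
        = (of_nat k + 1) ^ (k + 1) * ((c - 1) * poly P c)"
      unfolding c1[symmetric] by (simp add: mult_ac)
    also have "\<dots> = (c ^ k * (of_nat k + 1) ^ k) * ((c - 2) * (of_nat k + 1)) + (of_nat k + 1) ^ (k + 1)"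
      unfolding hP by (simp add: algebra_simps)
    also have "\<dots> = - of_int (disc_num k)"
      unfolding ck ck1 by (simp add: disc_num_def)
    finally show ?thesis .
  qed
  have X: "disc_num k > 0" using k by (rule disc_num_pos)
  obtain as where as: "smult (lead_coeff P) (\<Prod>a\<leftarrow>as. [:- a, 1:]) = P" "length as = k"
    using fundamental_theorem_algebra_factorized[of P] degP by auto
  have P: "P = (\<Prod>i<k. [:- (as ! i), 1:])"
    using as by (simp add: lcP prod_list_eq_prod_nth)
  have poly_P: "poly P x = (\<Prod>i<k. x - as ! i)" for x unfolding P by (simp add: poly_prod)
  have root: "poly P (as ! i) = 0" if "i < k" for i using that by (auto simp: poly_P)
  have P0: "poly P 0 \<noteq> 0" using hP[of 0] k by (auto simp: power_0_left)
  have "poly (pderiv P) (as ! i) \<noteq> 0" if "i < k" for i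
  proof
    assume "poly (pderiv P) (as ! i) = 0"
    with deriv[OF root[OF that]] have "as ! i = 0 \<or> (of_nat k + 1) * (as ! i) = 2 * of_nat k" by auto
    then have "as ! i = 0 \<or> as ! i = c" using k1 by (auto simp: c_def field_simps)
    then have "poly P 0 = 0 \<or> poly P c = 0" using root[OF that] by auto
    with P0 Pc X show False by auto
  qed
  note simple = this
  have inj: "inj_on (\<lambda>i. as ! i) {..<k}"
  proof (rule inj_onI, rule ccontr)
    fix i j assume ij: "i \<in> {..<k}" "j \<in> {..<k}" "as ! i = as ! j" "i \<noteq> j"
    let ?q = "\<Prod>l\<in>{..<k} - {i}. [:- (as ! l), 1:]"
    have "P = [:- (as ! i), 1:] * ?q" unfolding P using ij(1) by (intro prod.remove) auto
    then have "poly (pderiv P) (as ! i) = poly (pderiv ([:- (as ! i), 1:] * ?q)) (as ! i)" by (rule arg_cong)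
    also have "\<dots> = poly ?q (as ! i)"
      unfolding pderiv_mult by (simp add: pderiv_pCons)
    also have "\<dots> = 0" using ij by (auto simp: poly_prod)
    finally show False using simple ij by auto
  qed
  have "of_int (resultant g (pderiv g)) = resultant P (pderiv P)"
    unfolding P_def of_int_hom.map_poly_pderiv[symmetric] by (rule of_int_hom.resultant_hom[symmetric])
  also have "\<dots> = (\<Prod>i<k. poly (pderiv P) (as ! i))"
    using resultant_prod_linear[OF inj] P by metis
  finally have res: "of_int (resultant g (pderiv g)) = (\<Prod>i<k. poly (pderiv P) (as ! i))" .
  have norm1: "cmod (\<Prod>i<k. as ! i - 1) = of_nat k - 1"
  proof -
    have "poly P 1 = 1 - of_nat k"
      unfolding P_def g_def char_poly_g_def by (simp add: hom_distribs poly_sum poly_monom)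
    moreover have "cmod (\<Prod>i<k. as ! i - 1) = cmod (poly P 1)"
      unfolding poly_P prod_norm[symmetric] by (simp only: norm_minus_commute)
    ultimately have "cmod (\<Prod>i<k. as ! i - 1) = cmod (1 - of_nat k)" by (simp only:)
    also have "(1 - of_nat k :: complex) = of_real (1 - real k)" by simp
    also have "cmod \<dots> = of_nat k - 1" unfolding norm_of_real using k by simp
    finally show ?thesis .
  qed
  have norm0: "cmod (\<Prod>i<k. as ! i) = 1"
  proof -
    have "- poly P 0 = 1" using hP[of 0] k by (simp add: power_0_left)
    then have "cmod (poly P 0) = 1" by (metis norm_minus_cancel norm_one)
    moreover have "cmod (poly P 0) = cmod (\<Prod>i<k. as ! i)"
      unfolding poly_P prod_norm[symmetric] by simp
    ultimately show ?thesis by (simp only:)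
  qed
  have normc: "cmod (\<Prod>i<k. (of_nat k + 1) * as ! i - 2 * of_nat k) = cmod ((of_nat k + 1) ^ k * poly P c)"
  proof -
    have "(of_nat k + 1) * (c - x) = 2 * of_nat k - (of_nat k + 1) * x" for x
      using k1 by (simp add: c_def field_simps)
    note scale = this
    have "(of_nat k + 1) ^ k * poly P c = (\<Prod>i<k. of_nat k + 1) * (\<Prod>i<k. c - as ! i)"
      unfolding poly_P by simp
    also have "\<dots> = (\<Prod>i<k. (of_nat k + 1) * (c - as ! i))" by (rule prod.distrib[symmetric])
    also have "\<dots> = (\<Prod>i<k. 2 * of_nat k - (of_nat k + 1) * as ! i)" by (simp only: scale)
    finally have "(of_nat k + 1) ^ k * poly P c = (\<Prod>i<k. 2 * of_nat k - (of_nat k + 1) * as ! i)" .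
    then show ?thesis by (simp only: prod_norm[symmetric] norm_minus_commute)
  qed
  have "(\<Prod>i<k. as ! i - 1) * of_int (resultant g (pderiv g))
      = (\<Prod>i<k. as ! i) ^ (k - 1) * (\<Prod>i<k. (of_nat k + 1) * as ! i - 2 * of_nat k)"
    unfolding res prod_power_distrib prod.distrib[symmetric]
    by (intro prod.cong refl) (use deriv root in auto)
  then have "cmod ((\<Prod>i<k. as ! i - 1) * of_int (resultant g (pderiv g)))
      = cmod ((\<Prod>i<k. as ! i) ^ (k - 1) * (\<Prod>i<k. (of_nat k + 1) * as ! i - 2 * of_nat k))" by simp
  then have 1: "(real k - 1) * real_of_int \<bar>resultant g (pderiv g)\<bar> = cmod ((of_nat k + 1) ^ k * poly P c)"
    by (simp add: norm_mult norm_power norm0 norm1 normc del: prod.distrib)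
  have "(real k - 1) * cmod ((of_nat k + 1) ^ k * poly P c)
      = cmod ((of_nat k - 1) * (of_nat k + 1) ^ k * poly P c)"
  proof -
    have "(of_nat k - 1 :: complex) = of_real (real k - 1)" by simp
    then have "cmod (of_nat k - 1) = real k - 1" using k by (simp only: norm_of_real)
    then show ?thesis by (simp add: norm_mult mult.assoc)
  qed
  also have "\<dots> = of_int (disc_num k)"
    unfolding Pc using X by simp
  finally have "real_of_int (\<bar>resultant g (pderiv g)\<bar> * (int k - 1)\<^sup>2) = of_int (disc_num k)"
    unfolding 1[symmetric] by (simp add: power2_eq_square mult_ac)
  then have "\<bar>resultant g (pderiv g)\<bar> * (int k - 1)\<^sup>2 = disc_num k" by (simp only: of_int_eq_iff)
  moreover have "\<bar>discriminant g\<bar> = \<bar>resultant g (pderiv g)\<bar>"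
    using lc by (simp add: discriminant_def abs_mult power_abs)
  ultimately show ?thesis by (simp add: g_def)
qed


section \<open>Generalized Lucas numbers\<close>

definition lucas :: "nat \<Rightarrow> nat \<Rightarrow> int" where
  "lucas k n = gen_lucas k (int n)"

lemma gen_lucas_neg: "n < 0 \<Longrightarrow> gen_lucas k n = 0"
  by (simp add: gen_lucas.simps)

lemma lucas_0 [simp]: "lucas k 0 = 2" and lucas_1 [simp]: "lucas k (Suc 0) = 1"
  by (simp_all add: lucas_def gen_lucas.simps[of k 0] gen_lucas.simps[of k 1])

lemma gen_lucas_sum:
  "n \<ge> 2 \<Longrightarrow> gen_lucas k n = (\<Sum>i\<in>{1..k}. gen_lucas k (n - int i))"
  by (subst gen_lucas.simps) simp

lemma lucas_2:
  assumes "k \<ge> 2"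
  shows "lucas k 2 = 3"
proof -
  have "lucas k 2 = (\<Sum>i\<in>{1..k}. gen_lucas k (2 - int i))"
    by (simp add: lucas_def gen_lucas_sum)
  also have "\<dots> = (\<Sum>i\<in>{1, 2}. gen_lucas k (2 - int i))"
    using assms by (intro sum.mono_neutral_right) (auto simp: gen_lucas_neg)
  also have "\<dots> = 3" using lucas_0[of k] lucas_1[of k] by (simp add: lucas_def)
  finally show ?thesis .
qed

lemma window_sum_shift:
  fixes F :: "int \<Rightarrow> int"
  shows "(\<Sum>i\<in>{1..k}. F (n + 1 - int i)) + F (n - int k) = F n + (\<Sum>i\<in>{1..k}. F (n - int i))"
  by (induction k) (auto simp: algebra_simps)

text \<open>Consecutive windows of the defining sum differ only in their end terms. The start
  \<open>n >= 2\<close> matters: the value 1 at index 1 is an initial value, so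
  \<open>lucas k 2 = 3\<close> does not arise by doubling.\<close>

lemma lucas_rec:
  assumes "n \<ge> 2"
  shows "lucas k (Suc n) = 2 * lucas k n - (if k \<le> n then lucas k (n - k) else 0)"
proof -
  have "gen_lucas k (int n + 1) = (\<Sum>i\<in>{1..k}. gen_lucas k (int n + 1 - int i))"
    using assms by (simp add: gen_lucas_sum)
  moreover have "gen_lucas k (int n) = (\<Sum>i\<in>{1..k}. gen_lucas k (int n - int i))"
    using assms by (simp add: gen_lucas_sum)
  ultimately have "gen_lucas k (int n + 1) = 2 * gen_lucas k (int n) - gen_lucas k (int n - int k)"
    using window_sum_shift[of "gen_lucas k" "int n" k] by linarith
  then show ?thesis
    by (auto simp: lucas_def gen_lucas_neg of_nat_diff add.commute)
qed

lemma lucas_nonneg: "lucas k n \<ge> 0"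
proof (induction n rule: less_induct)
  case (less n)
  have "gen_lucas k (int n) \<ge> 0"
  proof (cases "n \<ge> 2")
    case True
    have "gen_lucas k (int n - int i) \<ge> 0" if "i \<in> {1..k}" for i
    proof (cases "i \<le> n")
      case True
      then show ?thesis using less[of "n - i"] that \<open>n \<ge> 2\<close> by (simp add: lucas_def of_nat_diff)
    qed (simp add: gen_lucas_neg)
    then have "(\<Sum>i\<in>{1..k}. gen_lucas k (int n - int i)) \<ge> 0" by (rule sum_nonneg)
    then show ?thesis using True by (simp add: gen_lucas_sum)
  next
    case False
    then have "n = 0 \<or> n = Suc 0" by auto
    then show ?thesis using lucas_0[of k] lucas_1[of k] by (auto simp: lucas_def)
  qed
  then show ?case by (simp add: lucas_def)
qed

lemma lucas_le_Suc:
  assumes "n \<ge> 1" "k \<ge> 1"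
  shows "lucas k n \<le> lucas k (Suc n)"
proof -
  have nonneg: "gen_lucas k i \<ge> 0" for i
    using lucas_nonneg[of k "nat i"] by (cases "i \<ge> 0") (auto simp: lucas_def gen_lucas_neg)
  have "lucas k n = (\<Sum>i\<in>{1}. gen_lucas k (int (Suc n) - int i))" by (simp add: lucas_def)
  also have "\<dots> \<le> (\<Sum>i\<in>{1..k}. gen_lucas k (int (Suc n) - int i))"
    using assms nonneg by (intro sum_mono2) auto
  also have "\<dots> = lucas k (Suc n)"
    unfolding lucas_def using assms by (intro gen_lucas_sum[symmetric]) simp
  finally show ?thesis .
qed

lemma lucas_mono:
  assumes "1 \<le> n" "n \<le> n'" "k \<ge> 1"
  shows "lucas k n \<le> lucas k n'"
  using assms(2) by (induction n' rule: dec_induct)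
    (use assms in \<open>auto intro: order.trans[OF _ lucas_le_Suc]\<close>)

section \<open>Size of the generalized Lucas numbers\<close>

lemma lucas_upper:
  assumes "n \<ge> 1" "k \<ge> 2"
  shows "4 * lucas k n \<le> 3 * 2 ^ n"
  using assms(1)
proof (induction n rule: dec_induct)
  case (step n)
  show ?case
  proof (cases "n = 1")
    case True
    then show ?thesis using lucas_2[OF assms(2)] by (simp add: numeral_2_eq_2)
  next
    case False
    then show ?thesis using step lucas_rec[of n k] lucas_nonneg[of k "n - k"] by auto
  qed
qed simp

lemma lucas_small:
  assumes "2 \<le> n" "n \<le> k"
  shows "4 * lucas k n = 3 * 2 ^ n"
  using assms
proof (induction n rule: dec_induct)
  case (step n)
  then show ?case using lucas_rec[of n k] by simp
qed (use lucas_2 in simp)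

text \<open>By the upper bound, the term subtracted when passing to index \<open>n + 1\<close> is at
  most \<open>3 / 4 * 2 ^ (n - k)\<close>, a fraction \<open>2 ^ (- (k + 1))\<close> of
  \<open>3 / 4 * 2 ^ (n + 1)\<close>. Each step thus adds one unit of \<open>2 ^ (- (k + 1))\<close>
  to the relative error.\<close>

lemma lucas_lower:
  assumes "n \<ge> 2" "k \<ge> 2"
  shows "4 * 2 ^ (k + 1) * lucas k n \<ge> 3 * 2 ^ n * (2 ^ (k + 1) - int n)"
proof (cases "n \<le> k")
  case True
  have "4 * 2 ^ (k + 1) * lucas k n = 2 ^ (k + 1) * (3 * 2 ^ n)"
    using lucas_small[OF assms(1) True] by (metis mult.commute mult.left_commute)
  moreover have "3 * 2 ^ n * (2 ^ (k + 1) - int n) \<le> 2 ^ (k + 1) * (3 * 2 ^ n)"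
    by (simp add: algebra_simps)
  ultimately show ?thesis by (simp only:)
next
  case False
  then have "k + 1 \<le> n" by simp
  then show ?thesis
  proof (induction n rule: dec_induct)
    \<comment> \<open>Here \<open>lucas k 0 = 2\<close> is subtracted, which violates the upper
      bound \<open>3 / 4 * 2 ^ 0\<close>. The loss is covered because the earlier steps cost
      nothing: \<open>8 <= 3 * (k + 1)\<close>.\<close>
    case base
    have "4 * lucas k (k + 1) = 3 * 2 ^ (k + 1) - 8"
      using lucas_small[of k k] lucas_rec[of k k] assms by simp
    then have "4 * 2 ^ (k + 1) * lucas k (k + 1) = 2 ^ (k + 1) * (3 * 2 ^ (k + 1) - 8)"
      by (metis mult.commute mult.left_commute)
    also have "\<dots> \<ge> 2 ^ (k + 1) * (3 * (2 ^ (k + 1) - int (k + 1)))"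
      using assms by (intro mult_left_mono) auto
    finally show ?case by (simp add: algebra_simps)
  next
    case (step n)
    have "4 * lucas k (n - k) \<le> 3 * 2 ^ (n - k)"
      using step(1) assms by (intro lucas_upper) auto
    then have "2 ^ (k + 1) * (4 * lucas k (n - k)) \<le> 2 ^ (k + 1) * (3 * 2 ^ (n - k))"
      by (intro mult_left_mono) auto
    also have "\<dots> = 3 * 2 ^ (k + 1 + (n - k))" by (simp add: power_add)
    also have "k + 1 + (n - k) = Suc n" using step(1) by simp
    finally have *: "4 * 2 ^ (k + 1) * lucas k (n - k) \<le> 3 * 2 ^ Suc n" by (simp add: mult_ac)
    have "lucas k (Suc n) = 2 * lucas k n - lucas k (n - k)"
      using lucas_rec[of n k] step(1) assms by simp
    then have "4 * 2 ^ (k + 1) * lucas k (Suc n)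
        = 2 * (4 * 2 ^ (k + 1) * lucas k n) - 4 * 2 ^ (k + 1) * lucas k (n - k)"
      by (simp only:) (simp add: algebra_simps)
    also have "\<dots> \<ge> 2 * (3 * 2 ^ n * (2 ^ (k + 1) - int n)) - 3 * 2 ^ Suc n"
      using step.IH * by linarith
    also have "2 * (3 * 2 ^ n * (2 ^ (k + 1) - int n)) - 3 * 2 ^ Suc n
        = 3 * 2 ^ Suc n * (2 ^ (k + 1) - int (Suc n))"
      by (simp add: algebra_simps)
    finally show ?case .
  qed
qed

section \<open>Powers of 2 dividing generalized Lucas numbers\<close>

lemma odd_lucas_mod:
  assumes "k \<ge> 2" "odd (lucas k n)"
  shows "n mod (k + 1) = 1 \<or> n mod (k + 1) = 2"
  using assms(2)
proof (induction n rule: less_induct)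
  case (less n)
  show ?case
  proof (cases "n \<le> k")
    case True
    consider "n = 0" | "n = 1" | "n = 2" | "n \<ge> 3" by linarith
    then show ?thesis
    proof cases
      case 4
      then obtain m where n: "n = m + 3" by (metis add.commute le_Suc_ex)
      then have "lucas k n = 2 * (3 * 2 ^ m)"
        using lucas_small[of n k] True by (simp add: power_add)
      then show ?thesis using less.prems by auto
    qed (use less.prems True assms(1) in auto)
  next
    case False
    define n' where "n' = n - (k + 1)"
    have n: "n = n' + (k + 1)" using False by (simp add: n'_def)
    \<comment> \<open>Modulo 2 the sequence has period \<open>k + 1\<close>, and among the indices
      up to \<open>k\<close> only 1 and 2 carry odd values, namely 1 and 3.\<close>
    have "lucas k n = 2 * lucas k (n' + k) - lucas k n'"
      using lucas_rec[of "n' + k" k] assms(1) n by simp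
    then have "odd (lucas k n')" using less.prems by auto
    then have "n' mod (k + 1) = 1 \<or> n' mod (k + 1) = 2" using less.IH[of n'] n by simp
    then show ?thesis by (simp only: n mod_add_self2)
  qed
qed

text \<open>
  The generating function of the sequence is \<open>(1 - x) (2 - x) / (1 - 2 x + x ^ (k + 1))\<close>. In its
  expansion by powers of \<open>- x ^ (k + 1)\<close>, the \<open>q\<close>-th coefficient is
  \<open>(1 - x) (2 - x) / (1 - 2 x) ^ (q + 1)\<close>, whose \<open>m\<close>-th coefficient is \<open>2 ^ m * row_coeff q m / 4\<close>.
\<close>

fun row_coeff :: "nat \<Rightarrow> nat \<Rightarrow> int" where
  "row_coeff 0 0 = 8"
| "row_coeff 0 (Suc 0) = 2"
| "row_coeff 0 (Suc (Suc m)) = 3"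
| "row_coeff (Suc q) 0 = 8"
| "row_coeff (Suc q) (Suc m) = row_coeff (Suc q) m + row_coeff q (Suc m)"

lemma row_coeff_0 [simp]: "row_coeff q 0 = 8"
  by (cases q) auto

text \<open>Each step along a row doubles, so \<open>2 ^ m\<close> and the modulus both gain a
  factor 2, and the recursion of \<open>row_coeff\<close> is left. At the start of a new row, four
  times the last term of the old row is a multiple of \<open>2 ^ k\<close>; doubled, it vanishes
  modulo \<open>2 ^ (k + 1)\<close>, and only the first term of the old row survives, with its sign
  changed.\<close>

lemma lucas_cong_row_coeff:
  assumes "k \<ge> 2" "m \<le> k"
  shows "2 ^ (k + 1 + m) dvd 4 * lucas k (q * (k + 1) + m) - (-1) ^ q * 2 ^ m * row_coeff q m"
  using assms(2)
proof (induction q arbitrary: m)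
  case 0
  consider "m = 0" | "m = 1" | "m \<ge> 2" by linarith
  then show ?case
  proof cases
    case 3
    then obtain m' where "m = Suc (Suc m')" by (metis add_2_eq_Suc le_Suc_ex)
    then show ?thesis using lucas_small[of m k] 0 3 by simp
  qed auto
next
  case (Suc q)
  note row = Suc.IH
  show ?case using Suc.prems
  proof (induction m)
    case 0
    have rec: "lucas k (Suc q * (k + 1)) = 2 * lucas k (q * (k + 1) + k) - lucas k (q * (k + 1))"
      using lucas_rec[of "q * (k + 1) + k" k] assms(1) by (simp add: algebra_simps)
    have "2 ^ (k + 1) dvd 4 * lucas k (q * (k + 1)) - (-1) ^ q * 8"
      using row[of 0] by simp
    moreover have "2 ^ (k + 1) dvd 2 * (4 * lucas k (q * (k + 1) + k))"
    proof -
      have 1: "(2::int) ^ k dvd 4 * lucas k (q * (k + 1) + k) - (-1) ^ q * 2 ^ k * row_coeff q k"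
        by (rule power_le_dvd[OF row[of k]]) auto
      have 2: "(2::int) ^ k dvd (-1) ^ q * 2 ^ k * row_coeff q k" by simp
      have "(2::int) ^ k dvd 4 * lucas k (q * (k + 1) + k)"
        using dvd_add[OF 1 2] by (simp only: diff_add_cancel)
      then have "(2::int) * 2 ^ k dvd 2 * (4 * lucas k (q * (k + 1) + k))"
        by (rule mult_dvd_mono[OF dvd_refl])
      then show ?thesis by simp
    qed
    ultimately have "2 ^ (k + 1) dvd 2 * (4 * lucas k (q * (k + 1) + k)) - (4 * lucas k (q * (k + 1)) - (-1) ^ q * 8)"
      by (blast intro: dvd_diff)
    also have "2 * (4 * lucas k (q * (k + 1) + k)) - (4 * lucas k (q * (k + 1)) - (-1) ^ q * 8)
        = 4 * lucas k (Suc q * (k + 1) + 0) - (-1) ^ Suc q * 2 ^ 0 * row_coeff (Suc q) 0"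
      unfolding add_0_right rec by simp
    finally show ?case by simp
  next
    case (Suc m)
    have rec: "lucas k (Suc q * (k + 1) + Suc m) = 2 * lucas k (Suc q * (k + 1) + m) - lucas k (q * (k + 1) + Suc m)"
      using lucas_rec[of "Suc q * (k + 1) + m" k] assms(1) by (simp add: algebra_simps)
    have "2 * 2 ^ (k + 1 + m) dvd 2 * (4 * lucas k (Suc q * (k + 1) + m) - (-1) ^ Suc q * 2 ^ m * row_coeff (Suc q) m)"
      using Suc by (intro mult_dvd_mono) auto
    moreover have "2 * 2 ^ (k + 1 + m) dvd 4 * lucas k (q * (k + 1) + Suc m) - (-1) ^ q * 2 ^ Suc m * row_coeff q (Suc m)"
      using row[of "Suc m"] Suc.prems by (simp add: mult_ac)
    ultimately have "2 * 2 ^ (k + 1 + m) dvd 2 * (4 * lucas k (Suc q * (k + 1) + m) - (-1) ^ Suc q * 2 ^ m * row_coeff (Suc q) m)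
        - (4 * lucas k (q * (k + 1) + Suc m) - (-1) ^ q * 2 ^ Suc m * row_coeff q (Suc m))"
      by (rule dvd_diff)
    also have "2 * (4 * lucas k (Suc q * (k + 1) + m) - (-1) ^ Suc q * 2 ^ m * row_coeff (Suc q) m)
        - (4 * lucas k (q * (k + 1) + Suc m) - (-1) ^ q * 2 ^ Suc m * row_coeff q (Suc m))
        = 4 * lucas k (Suc q * (k + 1) + Suc m) - (-1) ^ Suc q * 2 ^ Suc m * row_coeff (Suc q) (Suc m)"
      unfolding rec by (simp add: algebra_simps)
    finally show ?case by (simp add: mult_ac)
  qed
qed

text \<open>In the variable \<open>y = 2 * x\<close>, row \<open>q\<close> has the generating
  function \<open>(2 - y) * (4 - y) / (1 - y) ^ (q + 1)\<close>. The weights 3, 4, 1 come from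
  \<open>(2 - y) * (4 - y) = 3 + 4 * (1 - y) + (1 - y) ^ 2\<close>, and \<open>q = p + 2\<close>
  keeps all lower indices nonnegative.\<close>

lemma row_coeff_binomial:
  "row_coeff (p + 2) m = 3 * int ((m + p + 2) choose (p + 2)) + 4 * int ((m + p + 1) choose (p + 1))
     + int ((m + p) choose p)"
proof (induction p arbitrary: m)
  case 0
  have 1: "row_coeff 1 m = (if m = 0 then 8 else 3 * int m + 7)" for m
  proof (induction m)
    case (Suc m)
    then show ?case by (cases m) auto
  qed simp
  show ?case
  proof (induction m)
    case (Suc m)
    have "int (Suc m choose 2) = int (m choose 2) + int m" by (simp add: numeral_2_eq_2)
    then show ?case using Suc 1[of "Suc m"] by (simp add: numeral_2_eq_2)
  qed simp
next
  case (Suc p)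
  note row = this
  show ?case
  proof (induction m)
    case (Suc m)
    then show ?case using row[of "Suc m"] by simp
  qed simp
qed

text \<open>The cofactor of \<open>(m + p) choose p\<close> once the three binomial coefficients are
  brought over the denominator \<open>(p + 2) * (p + 1)\<close>. The 2-part of the binomial
  coefficient is small for arithmetic reasons, that of this positive quadratic simply because of its
  size.\<close>

definition row_quad :: "nat \<Rightarrow> nat \<Rightarrow> nat" where
  "row_quad p m = (m + p + 1) * (3 * m + 7 * p + 14) + (p + 2) * (p + 1)"

lemma row_coeff_factor:
  "int ((p + 2) * (p + 1)) * row_coeff (p + 2) m = int (((m + p) choose p) * row_quad p m)"
proof -
  have 1: "(p + 1) * ((m + p + 1) choose (p + 1)) = (m + p + 1) * ((m + p) choose p)"
    using Suc_times_binomial[of p "m + p"] by simp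
  have "(p + 2) * ((m + p + 2) choose (p + 2)) = (m + p + 2) * ((m + p + 1) choose (p + 1))"
    using Suc_times_binomial[of "p + 1" "m + p + 1"] by simp
  then have 2: "(p + 2) * (p + 1) * ((m + p + 2) choose (p + 2)) = (m + p + 2) * (m + p + 1) * ((m + p) choose p)"
    using 1 by (metis mult.assoc mult.left_commute)
  have "int ((p + 2) * (p + 1)) * row_coeff (p + 2) m
     = int (3 * ((p + 2) * (p + 1) * ((m + p + 2) choose (p + 2)))
        + 4 * ((p + 2) * ((p + 1) * ((m + p + 1) choose (p + 1)))) + (p + 2) * (p + 1) * ((m + p) choose p))"
    unfolding row_coeff_binomial of_nat_add of_nat_mult by (simp only: ring_distribs mult_ac of_nat_numeral)
  also have "\<dots> = int (((m + p) choose p) * row_quad p m)"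
    unfolding 1 2 row_quad_def by (rule arg_cong[where f = int]) (simp add: algebra_simps)
  finally show ?thesis .
qed

text \<open>
  Leibniz's identity \<open>1 / (j (N choose j)) = 1 / (j (N - 1 choose j)) - 1 / ((j + 1) (N choose j + 1))\<close>
  drives the induction.
\<close>

lemma binomial_dvd_common_multiple:
  assumes "1 \<le> j" "j \<le> N" "\<And>i. 1 \<le> i \<Longrightarrow> i \<le> N \<Longrightarrow> i dvd D"
  shows "int (j * (N choose j)) dvd int D"
  using assms
proof (induction "N - j" arbitrary: N j)
  case 0
  then show ?case by (auto simp: le_antisym)
next
  case (Suc x)
  then have jN: "j < N" by simp
  define c where "c = int (N choose j)"
  have "int (j * ((N - 1) choose j)) dvd int D"
    using Suc.prems jN Suc.hyps(2) by (intro Suc.hyps(1)) auto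
  then obtain x where x: "int D = int (j * ((N - 1) choose j)) * x" by (rule dvdE)
  have "int (Suc j * (N choose Suc j)) dvd int D"
    using Suc.prems jN Suc.hyps(2) by (intro Suc.hyps(1)) auto
  then obtain y where y: "int D = int (Suc j * (N choose Suc j)) * y" by (rule dvdE)
  have "(N - j) * (N choose j) = N * ((N - 1) choose j)"
    using binomial_absorb_comp[of N j] .
  then have 1: "int N * int ((N - 1) choose j) = (int N - int j) * c"
    using jN unfolding c_def by (metis less_imp_le of_nat_diff of_nat_mult)
  have "Suc j * (N choose Suc j) = (N - j) * (N choose j)"
    by (metis binomial_absorb_comp binomial_absorption)
  then have 2: "int (Suc j * (N choose Suc j)) = (int N - int j) * c"
    using jN unfolding c_def by (simp add: of_nat_diff)
  have "int D * int N = int j * x * (int N * int ((N - 1) choose j))" unfolding x by simp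
  then have 3: "int D * int N = int j * x * ((int N - int j) * c)" unfolding 1 .
  have 4: "int D = (int N - int j) * c * y" using y unfolding 2 .
  have "(int N - int j) * (int j * c * (x - y))
      = int j * x * ((int N - int j) * c) - int j * ((int N - int j) * c * y)"
    by (simp add: algebra_simps)
  also have "\<dots> = int D * int N - int j * int D" by (simp only: 3[symmetric] 4[symmetric])
  finally have "(int N - int j) * int D = (int N - int j) * (int j * c * (x - y))"
    by (simp add: algebra_simps)
  then have "int D = int j * c * (x - y)" using jN by simp
  then show ?case by (simp add: c_def)
qed

text \<open>A common multiple \<open>D\<close> of 1, ..., \<open>N\<close> can be chosen with 2-part
  \<open>2 ^ e <= N\<close>: the product of all odd parts times the largest power of 2 up to
  \<open>N\<close>. Since \<open>N choose j\<close> divides \<open>D\<close> for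
  \<open>j > 0\<close>, its 2-part is no larger.\<close>

lemma power2_dvd_binomial_le:
  assumes "2 ^ a dvd (N choose j)" "j \<le> N"
  shows "2 ^ a \<le> N + 1"
proof (cases "j = 0")
  case True
  then show ?thesis using assms by simp
next
  case False
  then have N: "N > 0" using assms by simp
  obtain e where e: "2 ^ e \<le> N" "N < 2 ^ (e + 1)" using ex_power_ivl1[of 2 N] N by auto
  define odd_part where "odd_part i = i div 2 ^ multiplicity 2 i" for i :: nat
  have decomp: "i = 2 ^ multiplicity 2 i * odd_part i" "odd (odd_part i)" if "i \<ge> 1" for i
    using that by (auto simp: odd_part_def multiplicity_dvd multiplicity_decompose)
  define D where "D = 2 ^ e * (\<Prod>i\<in>{1..N}. odd_part i)"
  have "i dvd D" if "1 \<le> i" "i \<le> N" for i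
  proof -
    have "2 ^ multiplicity 2 i \<le> i" using that by (intro dvd_imp_le multiplicity_dvd) auto
    also have "i < 2 ^ (e + 1)" using that e by simp
    finally have "multiplicity 2 i < e + 1" by (subst (asm) power_strict_increasing_iff) auto
    then have "(2::nat) ^ multiplicity 2 i dvd 2 ^ e" by (intro le_imp_power_dvd) auto
    moreover have "odd_part i dvd (\<Prod>i\<in>{1..N}. odd_part i)" using that by (intro dvd_prodI) auto
    ultimately show ?thesis unfolding D_def using decomp(1)[OF that(1)] by (metis mult_dvd_mono)
  qed
  then have "int (j * (N choose j)) dvd int D"
    using False assms(2) by (intro binomial_dvd_common_multiple) auto
  then have "2 ^ a dvd D" using assms(1) by (meson dvd_mult dvd_trans int_dvd_int_iff)
  moreover have "coprime (2 ^ a) (\<Prod>i\<in>{1..N}. odd_part i)"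
    using decomp(2) by (intro prod_coprime_right) auto
  ultimately have "2 ^ a dvd (2::nat) ^ e" unfolding D_def by (simp add: coprime_dvd_mult_left_iff)
  then have "2 ^ a \<le> (2::nat) ^ e" by (intro dvd_imp_le) auto
  with e(1) show ?thesis by linarith
qed

text \<open>The congruence transfers the divisibility to \<open>row_coeff\<close>, after cancelling
  \<open>2 ^ m\<close>. The remaining power of 2 splits into a divisor of the binomial coefficient
  and a divisor of \<open>row_quad\<close>. For large \<open>k\<close> the bound forces
  \<open>m\<close> to be close to \<open>k + 1\<close>.\<close>

lemma power2_dvd_lucas_bound:
  assumes k: "k \<ge> 2" and m: "m \<le> k" and dvd: "2 ^ (k - 1) dvd lucas k ((p + 2) * (k + 1) + m)"
  shows "2 ^ (k + 1 - m) \<le> (m + p + 1) * row_quad p m"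
proof -
  let ?l = "lucas k ((p + 2) * (k + 1) + m)"
  have "2 ^ 2 * 2 ^ (k - 1) dvd 4 * ?l" using dvd by (intro mult_dvd_mono) auto
  also have "(2::int) ^ 2 * 2 ^ (k - 1) = 2 ^ (k + 1)"
    unfolding power_add[symmetric] using k by (intro arg_cong[of _ _ "\<lambda>n. 2 ^ n"]) simp
  finally have 1: "2 ^ (k + 1) dvd 4 * ?l" .
  have "(2::int) ^ (k + 1) dvd 4 * ?l - (-1) ^ (p + 2) * 2 ^ m * row_coeff (p + 2) m"
    using lucas_cong_row_coeff[OF k m, of "p + 2"] by (rule power_le_dvd) simp
  then have "(2::int) ^ (k + 1) dvd 4 * ?l - (4 * ?l - (-1) ^ (p + 2) * 2 ^ m * row_coeff (p + 2) m)"
    using 1 by (rule dvd_diff[rotated])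
  then have "(2::int) ^ (k + 1) dvd (-1) ^ (p + 2) * (2 ^ m * row_coeff (p + 2) m)" by (simp add: mult.assoc)
  then have "(2::int) ^ (k + 1) dvd 2 ^ m * row_coeff (p + 2) m"
    by (simp add: minus_one_power_iff split: if_splits)
  moreover have "(2::int) ^ (k + 1) = 2 ^ m * 2 ^ (k + 1 - m)"
    unfolding power_add[symmetric] using m by simp
  ultimately have "(2::int) ^ (k + 1 - m) dvd row_coeff (p + 2) m" by simp
  then have "(2::int) ^ (k + 1 - m) dvd int (((m + p) choose p) * row_quad p m)"
    unfolding row_coeff_factor[symmetric] by (rule dvd_mult)
  then have "2 ^ (k + 1 - m) dvd ((m + p) choose p) * row_quad p m"
    by (metis int_dvd_int_iff of_nat_numeral of_nat_power)
  then obtain b c where bc: "2 ^ (k + 1 - m) = b * c" "b dvd ((m + p) choose p)" "c dvd row_quad p m"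
    using division_decomp by blast
  then obtain a where "b = 2 ^ a" using divides_primepow_nat[of 2 b "k + 1 - m"] by (metis dvd_triv_left two_is_prime_nat)
  then have "b \<le> m + p + 1" using power2_dvd_binomial_le[of a "m + p" p] bc(2) by simp
  moreover have "c \<le> row_quad p m" using bc(3) by (rule dvd_imp_le) (simp add: row_quad_def)
  ultimately show ?thesis unfolding bc(1) by (rule mult_le_mono)
qed

lemma binomial_cong_square:
  fixes x :: int
  shows "x\<^sup>2 dvd (1 + x) ^ n - (1 + int n * x)"
proof (induction n)
  case (Suc n)
  have "(1 + x) ^ Suc n - (1 + int (Suc n) * x) = (1 + x) * ((1 + x) ^ n - (1 + int n * x)) + x\<^sup>2 * int n"
    by (simp add: algebra_simps power2_eq_square)
  then show ?case using Suc by simp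
qed simp


section \<open>Pade approximants of powers\<close>

text \<open>The sum is the \<open>d\<close>-th forward difference at \<open>m\<close> of the
  polynomial \<open>x choose p\<close>, and each difference lowers \<open>p\<close> by one.\<close>

lemma alternating_binomial_shift:
  fixes m p d :: nat
  shows "(\<Sum>i\<le>d. (-1) ^ (d - i) * int (d choose i) * int ((m + i) choose p))
       = (if d \<le> p then int (m choose (p - d)) else 0)"
proof (induction d arbitrary: p m)
  case 0
  then show ?case by simp
next
  case (Suc d)
  define f where "f i = int ((m + i) choose p)" for i
  define g where "g i = int ((Suc m + i) choose p)" for i
  have split: "(\<Sum>i\<le>Suc d. (-1) ^ (Suc d - i) * int (Suc d choose i) * f i)
      = (\<Sum>i\<le>d. (-1) ^ (d - i) * int (d choose i) * f (Suc i))
        - (\<Sum>i\<le>d. (-1) ^ (d - i) * int (d choose i) * f i)"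
  proof -
    have "(\<Sum>i\<le>Suc d. (-1) ^ (Suc d - i) * int (Suc d choose i) * f i)
        = (-1) ^ Suc d * f 0 + (\<Sum>i\<le>d. (-1) ^ (d - i) * int (Suc d choose Suc i) * f (Suc i))"
      by (subst sum.atMost_Suc_shift) simp
    also have "(\<Sum>i\<le>d. (-1) ^ (d - i) * int (Suc d choose Suc i) * f (Suc i))
        = (\<Sum>i\<le>d. (-1) ^ (d - i) * int (d choose i) * f (Suc i))
          + (\<Sum>i\<le>d. (-1) ^ (d - i) * int (d choose Suc i) * f (Suc i))"
      by (simp add: sum.distrib[symmetric] algebra_simps)
    also have "(-1) ^ Suc d * f 0 + ((\<Sum>i\<le>d. (-1) ^ (d - i) * int (d choose i) * f (Suc i))
          + (\<Sum>i\<le>d. (-1) ^ (d - i) * int (d choose Suc i) * f (Suc i)))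
        = (\<Sum>i\<le>d. (-1) ^ (d - i) * int (d choose i) * f (Suc i))
          + (\<Sum>i\<le>Suc d. (-1) ^ (Suc d - i) * int (d choose i) * f i)"
      using sum.atMost_Suc_shift[of "\<lambda>i. (-1) ^ (Suc d - i) * int (d choose i) * f i" d] by simp
    also have "(\<Sum>i\<le>Suc d. (-1) ^ (Suc d - i) * int (d choose i) * f i)
        = - (\<Sum>i\<le>d. (-1) ^ (d - i) * int (d choose i) * f i)"
      by (simp add: Suc_diff_le sum_negf[symmetric])
    finally show ?thesis by simp
  qed
  have f_Suc: "f (Suc i) = (if p = 0 then 0 else int ((m + i) choose (p - 1))) + f i" for i
    unfolding f_def by (cases p) auto
  have "(\<Sum>i\<le>Suc d. (-1) ^ (Suc d - i) * int (Suc d choose i) * f i)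
      = (\<Sum>i\<le>d. (-1) ^ (d - i) * int (d choose i) *
          (if p = 0 then 0 else int ((m + i) choose (p - 1))))"
    unfolding split sum_subtractf[symmetric] f_Suc by (simp add: algebra_simps)
  also have "\<dots> = (if Suc d \<le> p then int (m choose (p - Suc d)) else 0)"
    using Suc.IH[of m "p - 1"] by (cases p) auto
  finally show ?case unfolding f_def .
qed

text \<open>
  With \<open>k = m + d + 1\<close>, the numbers \<open>pade_num m d i\<close> are the coefficients of a polynomial \<open>U\<close> of
  degree \<open>d\<close> such that the \<open>(d + 1)\<close>-st derivative of \<open>x ^ k * U x\<close> is a multiple of
  \<open>x ^ m * (x - 1) ^ d\<close>. Hence the coefficients \<open>pade_rem m d n\<close> of \<open>(1 + z) ^ k * U (1 + z)\<close>
  vanish for \<open>d < n \<le> 2 d\<close>.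
\<close>

definition pade_num :: "nat \<Rightarrow> nat \<Rightarrow> nat \<Rightarrow> int" where
  "pade_num m d i = (-1) ^ (d - i) * int ((m + i) choose i) * int ((m + 2 * d + 1) choose (d - i))"

definition pade_rem :: "nat \<Rightarrow> nat \<Rightarrow> nat \<Rightarrow> int" where
  "pade_rem m d n = (\<Sum>i\<le>d. pade_num m d i * int ((m + d + 1 + i) choose n))"

text \<open>After multiplication by these factorials, the three binomial coefficients of a summand
  collapse to \<open>(d choose i) * ((m + i) choose p)\<close> times a constant, so the sum is a
  \<open>d\<close>-th difference. For \<open>p < d\<close> it vanishes, which is the gap in the
  remainder.\<close>

lemma pade_rem_fact:
  "pade_rem m d (d + 1 + p) * int (fact m * fact d * fact (d + 1 + p))
     = int (fact (m + 2 * d + 1) * fact p * (if d \<le> p then m choose (p - d) else 0))"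
proof -
  have summand: "((m + i) choose i) * ((m + 2 * d + 1) choose (d - i)) * ((m + d + 1 + i) choose (d + 1 + p))
      * (fact m * fact d * fact (d + 1 + p))
      = fact (m + 2 * d + 1) * fact p * ((d choose i) * ((m + i) choose p))" if "i \<le> d" for i
  proof (cases "p \<le> m + i")
    case True
    let ?F = "\<lambda>n. fact n :: nat"
    have 1: "?F i * ?F m * ((m + i) choose i) = ?F (m + i)"
      using binomial_fact_lemma[of i "m + i"] by simp
    have 2: "?F (d - i) * ?F (m + d + 1 + i) * ((m + 2 * d + 1) choose (d - i)) = ?F (m + 2 * d + 1)"
      using binomial_fact_lemma[of "d - i" "m + 2 * d + 1"] that
      by (simp add: algebra_simps numeral_eq_Suc)
    have 3: "?F (d + 1 + p) * ?F (m + i - p) * ((m + d + 1 + i) choose (d + 1 + p)) = ?F (m + d + 1 + i)"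
      using binomial_fact_lemma[of "d + 1 + p" "m + d + 1 + i"] True
      by (simp add: algebra_simps)
    have 4: "?F i * ?F (d - i) * (d choose i) = ?F d"
      using binomial_fact_lemma[OF that] .
    have 5: "?F p * ?F (m + i - p) * ((m + i) choose p) = ?F (m + i)"
      using binomial_fact_lemma[OF True] .
    let ?K = "?F i * ?F (d - i) * ?F (m + i - p) * ?F (m + d + 1 + i)"
    have "?K * (((m + i) choose i) * ((m + 2 * d + 1) choose (d - i)) * ((m + d + 1 + i) choose (d + 1 + p))
      * (fact m * fact d * fact (d + 1 + p)))
      = (?F i * ?F m * ((m + i) choose i)) * (?F (d - i) * ?F (m + d + 1 + i) * ((m + 2 * d + 1) choose (d - i)))
        * (?F (d + 1 + p) * ?F (m + i - p) * ((m + d + 1 + i) choose (d + 1 + p))) * ?F d"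
      by (simp only: ac_simps)
    also have "\<dots> = ?F (m + i) * ?F (m + 2 * d + 1) * ?F (m + d + 1 + i) * ?F d"
      by (simp only: 1 2 3)
    also have "\<dots> = (?F p * ?F (m + i - p) * ((m + i) choose p)) * ?F (m + 2 * d + 1) * ?F (m + d + 1 + i)
        * (?F i * ?F (d - i) * (d choose i))"
      by (simp only: 4 5)
    also have "\<dots> = ?K * (fact (m + 2 * d + 1) * fact p * ((d choose i) * ((m + i) choose p)))"
      by (simp only: ac_simps)
    finally show ?thesis by simp
  next
    case False
    then show ?thesis by (simp add: binomial_eq_0)
  qed
  have "pade_rem m d (d + 1 + p) * int (fact m * fact d * fact (d + 1 + p))
      = (\<Sum>i\<le>d. (-1) ^ (d - i) * int (((m + i) choose i) * ((m + 2 * d + 1) choose (d - i))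
          * ((m + d + 1 + i) choose (d + 1 + p)) * (fact m * fact d * fact (d + 1 + p))))"
    unfolding pade_rem_def pade_num_def sum_distrib_right by (simp add: mult.assoc)
  also have "\<dots> = (\<Sum>i\<le>d. (-1) ^ (d - i) *
      int (fact (m + 2 * d + 1) * fact p * ((d choose i) * ((m + i) choose p))))"
    by (intro sum.cong refl) (simp only: summand atMost_iff)
  also have "\<dots> = int (fact (m + 2 * d + 1) * fact p) *
      (\<Sum>i\<le>d. (-1) ^ (d - i) * int (d choose i) * int ((m + i) choose p))"
    unfolding sum_distrib_left by (intro sum.cong refl) (simp add: mult.assoc mult.left_commute)
  finally show ?thesis unfolding alternating_binomial_shift by simp
qed

lemma pade_rem_eq_0:
  assumes "d < n" "n \<le> 2 * d"
  shows "pade_rem m d n = 0"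
proof -
  have 1: "d + 1 + (n - d - 1) = n" using assms(1) by simp
  have 2: "\<not> d \<le> n - d - 1" using assms by arith
  have "pade_rem m d n * int (fact m * fact d * fact n) = 0"
    using pade_rem_fact[of m d "n - d - 1"]
    by (simp only: 1 2 if_False mult_0_right of_nat_0)
  moreover have "int (fact m * fact d * fact n) \<noteq> 0" by (simp del: fact_Suc)
  ultimately show ?thesis by (simp only: mult_eq_0_iff) blast
qed

lemma pade_rem_first:
  "pade_rem m d (2 * d + 1) = int ((m + 2 * d + 1) choose (2 * d + 1))"
proof -
  let ?F = "\<lambda>n. fact n :: nat"
  have 1: "pade_rem m d (2 * d + 1) * int (?F m * ?F d * ?F (2 * d + 1))
      = int (?F (m + 2 * d + 1) * ?F d)"
  proof -
    have "d + 1 + d = 2 * d + 1" by simp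
    then show ?thesis using pade_rem_fact[of m d d]
      by (simp only: order.refl if_True diff_self_eq_0 binomial_n_0 mult_1_right)
  qed
  have "?F (2 * d + 1) * ?F m * ((m + 2 * d + 1) choose (2 * d + 1)) = ?F (m + 2 * d + 1)"
    using binomial_fact_lemma[of "2 * d + 1" "m + 2 * d + 1"] by simp
  then have "int (?F (m + 2 * d + 1) * ?F d)
      = int ((m + 2 * d + 1) choose (2 * d + 1)) * int (?F m * ?F d * ?F (2 * d + 1))"
    by (metis (no_types, lifting) mult.assoc mult.commute of_nat_mult)
  with 1 have "pade_rem m d (2 * d + 1) * int (?F m * ?F d * ?F (2 * d + 1))
    = int ((m + 2 * d + 1) choose (2 * d + 1)) * int (?F m * ?F d * ?F (2 * d + 1))" by simp
  moreover have "int (?F m * ?F d * ?F (2 * d + 1)) \<noteq> 0"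
    by (simp only: of_nat_eq_0_iff mult_eq_0_iff fact_nonzero simp_thms)
  ultimately show ?thesis by (simp only: mult_cancel_right) blast
qed

text \<open>The exact value is the upper bound times
  \<open>(2 d + 1)! (d + i)! / (d! (2 d + 1 + i)!)\<close>, a ratio equal to 1 at
  \<open>i = 0\<close> and never larger.\<close>

lemma pade_rem_bounds:
  "0 \<le> pade_rem m d (2 * d + 1 + i)"
  "pade_rem m d (2 * d + 1 + i) \<le> int ((m + 2 * d + 1) choose (2 * d + 1)) * int (m choose i)"
proof -
  let ?F = "\<lambda>n. fact n :: nat"
  let ?A = "?F m * ?F d * ?F (2 * d + 1 + i)"
  have 1: "pade_rem m d (2 * d + 1 + i) * int ?A
      = int (?F (m + 2 * d + 1) * ?F (d + i) * (m choose i))"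
  proof -
    have "d + 1 + (d + i) = 2 * d + 1 + i" by simp
    then show ?thesis using pade_rem_fact[of m d "d + i"]
      by (simp only: le_add1 if_True add_diff_cancel_left')
  qed
  have "0 < int ?A" by (simp only: of_nat_0_less_iff nat_0_less_mult_iff fact_gt_zero simp_thms)
  moreover have "0 \<le> pade_rem m d (2 * d + 1 + i) * int ?A" unfolding 1 by (rule of_nat_0_le_iff)
  ultimately show "0 \<le> pade_rem m d (2 * d + 1 + i)"
    by (metis mult_neg_pos not_less)
  have 2: "?F (2 * d + 1) * ?F m * ((m + 2 * d + 1) choose (2 * d + 1)) = ?F (m + 2 * d + 1)"
    using binomial_fact_lemma[of "2 * d + 1" "m + 2 * d + 1"] by simp
  have 3: "?F (2 * d + 1) * ?F (d + i) \<le> ?F d * ?F (2 * d + 1 + i)"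
  proof (induction i)
    case (Suc i)
    have "?F (2 * d + 1) * ?F (d + Suc i) = (d + Suc i) * (?F (2 * d + 1) * ?F (d + i))"
      by (simp only: add_Suc_right fact_Suc of_nat_id ac_simps)
    also have "\<dots> \<le> (2 * d + 1 + Suc i) * (?F d * ?F (2 * d + 1 + i))"
      by (rule mult_mono[OF _ Suc.IH]) simp_all
    also have "\<dots> = ?F d * ?F (2 * d + 1 + Suc i)"
      by (simp only: add_Suc_right fact_Suc of_nat_id mult_ac)
    finally show ?case .
  qed simp
  have "?F (m + 2 * d + 1) * ?F (d + i) * (m choose i)
      = ((m + 2 * d + 1) choose (2 * d + 1)) * (m choose i) * ?F m * (?F (2 * d + 1) * ?F (d + i))"
    unfolding 2[symmetric] by (simp only: ac_simps)
  also have "\<dots> \<le> ((m + 2 * d + 1) choose (2 * d + 1)) * (m choose i) * ?F m * (?F d * ?F (2 * d + 1 + i))"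
    by (rule mult_left_mono[OF 3]) simp
  also have "\<dots> = ((m + 2 * d + 1) choose (2 * d + 1)) * (m choose i) * ?A" by (simp only: ac_simps)
  finally have "pade_rem m d (2 * d + 1 + i) * int ?A
      \<le> int ((m + 2 * d + 1) choose (2 * d + 1)) * int (m choose i) * int ?A"
    unfolding 1 by (metis of_nat_le_iff of_nat_mult)
  then show "pade_rem m d (2 * d + 1 + i) \<le> int ((m + 2 * d + 1) choose (2 * d + 1)) * int (m choose i)"
    by (rule mult_right_le_imp_le) (rule \<open>0 < int ?A\<close>)
qed

text \<open>Beyond the gap all coefficients are nonnegative. The first one alone gives the lower
  bound, and the binomial theorem sums the upper bounds to \<open>(1 + z) ^ m\<close>.\<close>

lemma pade_binomial:
  fixes z :: real and m d :: nat
  assumes z: "z \<ge> 0"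
  defines "E \<equiv> (1 + z) ^ (m + d + 1) * (\<Sum>i\<le>d. of_int (pade_num m d i) * (1 + z) ^ i)
                - (\<Sum>n\<le>d. of_int (pade_rem m d n) * z ^ n)"
  shows "E \<ge> of_nat ((m + 2 * d + 1) choose (2 * d + 1)) * z ^ (2 * d + 1)"
    and "E \<le> of_nat ((m + 2 * d + 1) choose (2 * d + 1)) * z ^ (2 * d + 1) * (1 + z) ^ m"
proof -
  let ?C = "of_nat ((m + 2 * d + 1) choose (2 * d + 1)) :: real"
  have pow: "(1 + z) ^ (m + d + 1 + i) = (\<Sum>n\<le>m + 2 * d + 1. of_nat ((m + d + 1 + i) choose n) * z ^ n)"
    if "i \<le> d" for i
  proof -
    have "(1 + z) ^ (m + d + 1 + i) = (\<Sum>n\<le>m + d + 1 + i. of_nat ((m + d + 1 + i) choose n) * z ^ n)"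
      using binomial_ring[of z 1 "m + d + 1 + i"] by (simp add: add.commute)
    also have "\<dots> = (\<Sum>n\<le>m + 2 * d + 1. of_nat ((m + d + 1 + i) choose n) * z ^ n)"
      using that by (intro sum.mono_neutral_left) (auto simp: binomial_eq_0)
    finally show ?thesis .
  qed
  have "(1 + z) ^ (m + d + 1) * (\<Sum>i\<le>d. of_int (pade_num m d i) * (1 + z) ^ i)
      = (\<Sum>i\<le>d. of_int (pade_num m d i) * (1 + z) ^ (m + d + 1 + i))"
    by (simp add: sum_distrib_left power_add mult_ac)
  also have "\<dots> = (\<Sum>i\<le>d. \<Sum>n\<le>m + 2 * d + 1. of_int (pade_num m d i) *
        (of_nat ((m + d + 1 + i) choose n) * z ^ n))"
    by (intro sum.cong refl) (simp only: pow atMost_iff sum_distrib_left)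
  also have "\<dots> = (\<Sum>n\<le>m + 2 * d + 1. of_int (pade_rem m d n) * z ^ n)"
    unfolding pade_rem_def by (subst sum.swap) (simp add: sum_distrib_right mult.assoc)
  also have "\<dots> = (\<Sum>n\<in>{..d} \<union> {d<..2 * d} \<union> {2 * d + 1..m + 2 * d + 1}. of_int (pade_rem m d n) * z ^ n)"
    by (intro sum.cong) auto
  also have "\<dots> = (\<Sum>n\<le>d. of_int (pade_rem m d n) * z ^ n)
      + (\<Sum>n\<in>{d<..2 * d}. of_int (pade_rem m d n) * z ^ n)
      + (\<Sum>n\<in>{2 * d + 1..m + 2 * d + 1}. of_int (pade_rem m d n) * z ^ n)"
    by (subst sum.union_disjoint, simp, simp, force)+ simp
  also have "(\<Sum>n\<in>{d<..2 * d}. of_int (pade_rem m d n) * z ^ n) = 0"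
    by (intro sum.neutral) (auto simp: pade_rem_eq_0)
  also have "(\<Sum>n\<in>{2 * d + 1..m + 2 * d + 1}. of_int (pade_rem m d n) * z ^ n)
      = (\<Sum>i\<le>m. of_int (pade_rem m d (2 * d + 1 + i)) * z ^ (2 * d + 1 + i))"
    by (rule sum.reindex_bij_witness[of _ "\<lambda>i. 2 * d + 1 + i" "\<lambda>n. n - (2 * d + 1)"]) auto
  finally have E: "E = (\<Sum>i\<le>m. of_int (pade_rem m d (2 * d + 1 + i)) * z ^ (2 * d + 1 + i))"
    unfolding E_def by simp
  have "?C * z ^ (2 * d + 1) = of_int (pade_rem m d (2 * d + 1 + 0)) * z ^ (2 * d + 1 + 0)"
    unfolding add_0_right pade_rem_first by (simp only: of_int_of_nat_eq)
  also have "\<dots> = (\<Sum>i\<in>{0}. of_int (pade_rem m d (2 * d + 1 + i)) * z ^ (2 * d + 1 + i))"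
    by simp
  also have "\<dots> \<le> E" unfolding E
    by (intro sum_mono2) (use z pade_rem_bounds(1)[of m d] in auto)
  finally show "E \<ge> ?C * z ^ (2 * d + 1)" .
  have "E \<le> (\<Sum>i\<le>m. ?C * z ^ (2 * d + 1) * (of_nat (m choose i) * z ^ i))"
    unfolding E
  proof (intro sum_mono)
    fix i
    have "real_of_int (pade_rem m d (2 * d + 1 + i)) \<le> ?C * of_nat (m choose i)"
      using pade_rem_bounds(2)[of m d i] by (metis of_int_le_iff of_int_mult of_int_of_nat_eq)
    then have "of_int (pade_rem m d (2 * d + 1 + i)) * z ^ (2 * d + 1 + i)
        \<le> ?C * of_nat (m choose i) * z ^ (2 * d + 1 + i)"
      using z by (intro mult_right_mono) auto
    then show "of_int (pade_rem m d (2 * d + 1 + i)) * z ^ (2 * d + 1 + i)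
        \<le> ?C * z ^ (2 * d + 1) * (of_nat (m choose i) * z ^ i)"
      by (simp add: power_add mult_ac)
  qed
  also have "\<dots> = ?C * z ^ (2 * d + 1) * (1 + z) ^ m"
    using binomial_ring[of z 1 m] by (simp add: sum_distrib_left add.commute)
  finally show "E \<le> ?C * z ^ (2 * d + 1) * (1 + z) ^ m" .
qed


section \<open>Numerical bounds for logarithms\<close>

lemma ln_2_bounds: "69314717 / 10 ^ 8 < ln (2::real)" "ln (2::real) < 69314719 / 10 ^ 8"
proof -
  have "{..<8::nat} = {0, 1, 2, 3, 4, 5, 6, 7}" by auto
  then show "69314717 / 10 ^ 8 < ln (2::real)" "ln (2::real) < 69314719 / 10 ^ 8"
    using ln_approx_bounds[of 2 8] by (simp_all add: power_divide)
qed

lemma ln_3_bounds: "1098612 / 10 ^ 6 < ln (3::real)" "ln (3::real) < 1098613 / 10 ^ 6"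
proof -
  have 1: "ln (3::real) = 2 * ln 2 - ln (4 / 3)"
    using ln_realpow[of 2 2] by (simp add: ln_div)
  have 2: "{..<4::nat} = {0, 1, 2, 3}" by auto
  show "1098612 / 10 ^ 6 < ln (3::real)" "ln (3::real) < 1098613 / 10 ^ 6"
    unfolding 1 using ln_approx_bounds[of "4 / 3" 4] ln_2_bounds 2 by (simp_all add: power_divide)
qed

text \<open>The Taylor polynomials of \<open>ln (1 + r / 2 ^ s)\<close>, scaled by \<open>60 * 32 ^ s\<close>.\<close>

definition ln_lower :: "nat \<Rightarrow> int \<Rightarrow> int" where
  "ln_lower s r = 60 * r * 16 ^ s - 30 * r ^ 2 * 8 ^ s + 20 * r ^ 3 * 4 ^ s - 15 * r ^ 4 * 2 ^ s"

definition ln_upper :: "nat \<Rightarrow> int \<Rightarrow> int" where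
  "ln_upper s r = ln_lower s r + 12 * r ^ 5"

lemma ln_one_plus_Taylor_bounds:
  fixes z :: real
  assumes "z \<ge> 0"
  shows "z - z ^ 2 / 2 + z ^ 3 / 3 - z ^ 4 / 4 \<le> ln (1 + z)"
    and "ln (1 + z) \<le> z - z ^ 2 / 2 + z ^ 3 / 3 - z ^ 4 / 4 + z ^ 5 / 5"
proof -
  let ?p = "\<lambda>x::real. x - x ^ 2 / 2 + x ^ 3 / 3 - x ^ 4 / 4"
  have ln: "((\<lambda>x. ln (1 + x)) has_real_derivative 1 / (1 + x)) (at x)" if "x \<ge> 0" for x :: real
    using that by (auto intro!: derivative_eq_intros)
  have p: "(?p has_real_derivative (1 - x + x ^ 2 - x ^ 3)) (at x)" for x :: real
    by (auto intro!: derivative_eq_intros)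
  have q: "((\<lambda>x. ?p x + x ^ 5 / 5) has_real_derivative (1 - x + x ^ 2 - x ^ 3 + x ^ 4)) (at x)" for x :: real
    by (rule DERIV_add[OF p]) (auto intro!: derivative_eq_intros)
  have "ln (1 + 0) - ?p 0 \<le> ln (1 + z) - ?p z"
  proof (rule DERIV_nonneg_imp_nondecreasing[OF assms])
    fix x :: real
    assume x: "0 \<le> x"
    have "1 / (1 + x) - (1 - x + x ^ 2 - x ^ 3) = x ^ 4 / (1 + x)"
      using x by (simp add: field_simps eval_nat_numeral)
    also have "\<dots> \<ge> 0" using x by simp
    finally show "\<exists>y. ((\<lambda>x. ln (1 + x) - ?p x) has_real_derivative y) (at x) \<and> 0 \<le> y"
      using DERIV_diff[OF ln[OF x] p] by blast
  qed
  then show "?p z \<le> ln (1 + z)" by simp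
  have "(?p 0 + 0 ^ 5 / 5) - ln (1 + 0) \<le> (?p z + z ^ 5 / 5) - ln (1 + z)"
  proof (rule DERIV_nonneg_imp_nondecreasing[OF assms])
    fix x :: real
    assume x: "0 \<le> x"
    have "1 - x + x ^ 2 - x ^ 3 + x ^ 4 - 1 / (1 + x) = x ^ 5 / (1 + x)"
      using x by (simp add: field_simps eval_nat_numeral)
    also have "\<dots> \<ge> 0" using x by simp
    finally show "\<exists>y. ((\<lambda>x. (?p x + x ^ 5 / 5) - ln (1 + x)) has_real_derivative y) (at x) \<and> 0 \<le> y"
      using DERIV_diff[OF q ln[OF x]] by blast
  qed
  then show "ln (1 + z) \<le> ?p z + z ^ 5 / 5" by simp
qed

text \<open>The factor 60 clears the denominators 2, 3, 4, 5 of the Taylor polynomials and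
  \<open>32 ^ s = (2 ^ s) ^ 5\<close> those of the powers of \<open>z\<close>, so certificates need
  integer arithmetic only.\<close>

lemma ln_dyadic_bounds:
  assumes "r \<ge> 0"
  shows "of_int (ln_lower s r) \<le> 60 * 32 ^ s * ln (1 + of_int r / 2 ^ s :: real)"
    and "60 * 32 ^ s * ln (1 + of_int r / 2 ^ s :: real) \<le> of_int (ln_upper s r)"
proof -
  define z :: real where "z = of_int r / 2 ^ s"
  have z: "z \<ge> 0" using assms by (simp add: z_def)
  have r: "real_of_int r = z * 2 ^ s" by (simp add: z_def)
  have pow: "(4::real) ^ s = (2 ^ s) ^ 2" "(8::real) ^ s = (2 ^ s) ^ 3" "(16::real) ^ s = (2 ^ s) ^ 4"
    "(32::real) ^ s = (2 ^ s) ^ 5"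
    by (simp_all flip: power_mult power_mult_distrib add: mult.commute[of s] power_mult)
  have 1: "of_int (ln_lower s r) = 60 * 32 ^ s * (z - z ^ 2 / 2 + z ^ 3 / 3 - z ^ 4 / 4)"
    unfolding ln_lower_def of_int_diff of_int_add of_int_mult of_int_power r of_int_numeral pow
    by (simp add: algebra_simps eval_nat_numeral)
  have 2: "of_int (ln_upper s r) = 60 * 32 ^ s * (z - z ^ 2 / 2 + z ^ 3 / 3 - z ^ 4 / 4 + z ^ 5 / 5)"
    unfolding ln_upper_def of_int_add 1 of_int_mult of_int_power r of_int_numeral pow
    by (simp add: algebra_simps eval_nat_numeral)
  show "of_int (ln_lower s r) \<le> 60 * 32 ^ s * ln (1 + of_int r / 2 ^ s :: real)"
    unfolding 1 z_def[symmetric] by (intro mult_left_mono ln_one_plus_Taylor_bounds z) simp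
  show "60 * 32 ^ s * ln (1 + of_int r / 2 ^ s :: real) \<le> of_int (ln_upper s r)"
    unfolding 2 z_def[symmetric] by (intro mult_left_mono ln_one_plus_Taylor_bounds z) simp
qed

text \<open>
  A certificate that \<open>k ln (k / 2 ^ s) - 2 ln ((k - 1) / 2 ^ s) - ln 3\<close>, for \<open>k = 2 ^ s + r\<close>, lies
  strictly between \<open>t ln 2\<close> and \<open>(t + 1) ln 2\<close>. Both rational bounds for \<open>ln 2\<close> are tested since \<open>t\<close>
  may be negative.
\<close>

definition separated :: "nat \<Rightarrow> int \<Rightarrow> bool" where
  "separated s r =
    (let M = 60 * 32 ^ s;
         a = 10 ^ 6 * ((2 ^ s + r) * ln_lower s r - 2 * ln_upper s (r - 1));
         b = 10 ^ 6 * ((2 ^ s + r) * ln_upper s r - 2 * ln_lower s (r - 1));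
         t = (a div M - 1098613) div 693148
     in a > M * (1098613 + t * 693147 + 10) \<and> a > M * (1098613 + t * 693148 + 10)
        \<and> b < M * (1098612 + (t + 1) * 693147 - 10) \<and> b < M * (1098612 + (t + 1) * 693148 - 10))"

lemma mult_between_le:
  fixes c l u y :: real
  assumes "l \<le> c" "c \<le> u"
  shows "y * c \<le> y * l \<or> y * c \<le> y * u"
  using assms mult_left_mono[of c u y] mult_left_mono_neg[of l c y] by linarith

lemma mult_between_ge:
  fixes c l u y :: real
  assumes "l \<le> c" "c \<le> u"
  shows "y * c \<ge> y * l \<or> y * c \<ge> y * u"
  using assms mult_left_mono[of l c y] mult_left_mono_neg[of c u y] by linarith

text \<open>The integers \<open>a\<close> and \<open>b\<close> enclose \<open>M * G\<close>. The
  slack 10 in units of \<open>10 ^ (- 6)\<close> keeps \<open>G - ln 3\<close> away from both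
  neighbouring multiples of \<open>ln 2\<close>, and every integer \<open>t\<close> satisfies
  \<open>t <= u\<close> or \<open>t >= u + 1\<close>.\<close>

lemma separated_imp:
  fixes s :: nat and r t :: int
  assumes "separated s r" "r \<ge> 1"
  shows "\<bar>(2 ^ s + of_int r) * ln (1 + of_int r / 2 ^ s) - 2 * ln (1 + of_int (r - 1) / 2 ^ s)
           - ln 3 - of_int t * ln 2\<bar> > (1 / 10 ^ 6 :: real)"
proof -
  define G :: real where "G = (2 ^ s + of_int r) * ln (1 + of_int r / 2 ^ s) - 2 * ln (1 + of_int (r - 1) / 2 ^ s)"
  define M :: int where "M = 60 * 32 ^ s"
  define a where "a = (2 ^ s + r) * ln_lower s r - 2 * ln_upper s (r - 1)"
  define b where "b = (2 ^ s + r) * ln_upper s r - 2 * ln_lower s (r - 1)"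
  \<comment> \<open>A guess for the floor of \<open>(G - ln 3) / ln 2\<close>, which the four
    inequalities certify.\<close>
  define u where "u = (10 ^ 6 * a div M - 1098613) div 693148"
  have "10 ^ 6 * a > M * (1098613 + u * 693147 + 10) \<and> 10 ^ 6 * a > M * (1098613 + u * 693148 + 10)
     \<and> 10 ^ 6 * b < M * (1098612 + (u + 1) * 693147 - 10) \<and> 10 ^ 6 * b < M * (1098612 + (u + 1) * 693148 - 10)"
    using assms(1) unfolding separated_def Let_def u_def M_def a_def b_def .
  then have u: "10 ^ 6 * a > M * (1098613 + u * 693147 + 10)" "10 ^ 6 * a > M * (1098613 + u * 693148 + 10)"
     "10 ^ 6 * b < M * (1098612 + (u + 1) * 693147 - 10)" "10 ^ 6 * b < M * (1098612 + (u + 1) * 693148 - 10)"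
    by - (elim conjE, assumption)+
  have M: "real_of_int M = 60 * 32 ^ s" "real_of_int M > 0" by (auto simp: M_def)
  have MG: "M * G = (2 ^ s + of_int r) * (60 * 32 ^ s * ln (1 + of_int r / 2 ^ s))
      - 2 * (60 * 32 ^ s * ln (1 + of_int (r - 1) / 2 ^ s))"
    unfolding M G_def by (simp add: algebra_simps)
  have a: "real_of_int a = (2 ^ s + of_int r) * of_int (ln_lower s r) - 2 * of_int (ln_upper s (r - 1))"
    by (simp add: a_def)
  have b: "real_of_int b = (2 ^ s + of_int r) * of_int (ln_upper s r) - 2 * of_int (ln_lower s (r - 1))"
    by (simp add: b_def)
  have "of_int a \<le> M * G"
    unfolding MG a
    by (intro diff_mono mult_left_mono ln_dyadic_bounds) (use assms(2) in auto)
  have "M * G \<le> of_int b"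
    unfolding MG b
    by (intro diff_mono mult_left_mono ln_dyadic_bounds) (use assms(2) in auto)
  have lower: "10 ^ 6 * G > of_int (1098613 + v + 10)" if "10 ^ 6 * a > M * (1098613 + v + 10)" for v
  proof -
    have "real_of_int (M * (1098613 + v + 10)) < real_of_int (10 ^ 6 * a)"
      using that by (simp only: of_int_less_iff)
    then have "real_of_int M * real_of_int (1098613 + v + 10) < 10 ^ 6 * real_of_int a"
      by (simp only: of_int_mult of_int_power of_int_numeral)
    also have "\<dots> \<le> 10 ^ 6 * (M * G)" using \<open>of_int a \<le> M * G\<close> by simp
    finally have "real_of_int M * real_of_int (1098613 + v + 10) < M * (10 ^ 6 * G)" by (simp only: mult.left_commute)
    then show ?thesis using M(2) by (simp only: mult_less_cancel_left_pos)
  qed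
  have upper: "10 ^ 6 * G < of_int (1098612 + v - 10)" if "10 ^ 6 * b < M * (1098612 + v - 10)" for v
  proof -
    have "10 ^ 6 * (M * G) \<le> 10 ^ 6 * of_int b" using \<open>M * G \<le> of_int b\<close> by simp
    also have "10 ^ 6 * of_int b = real_of_int (10 ^ 6 * b)"
      by (simp only: of_int_mult of_int_power of_int_numeral)
    also have "\<dots> < real_of_int (M * (1098612 + v - 10))"
      using that by (simp only: of_int_less_iff)
    also have "\<dots> = real_of_int M * real_of_int (1098612 + v - 10)" by (simp only: of_int_mult)
    finally have "M * (10 ^ 6 * G) < real_of_int M * real_of_int (1098612 + v - 10)" by (simp only: mult.left_commute)
    then show ?thesis using M(2) by (simp only: mult_less_cancel_left_pos)
  qed
  have c: "693147 \<le> 10 ^ 6 * ln (2::real)" "10 ^ 6 * ln (2::real) \<le> 693148"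
    using ln_2_bounds by simp_all
  have "G - ln 3 - of_int t * ln 2 > 1 / 10 ^ 6 \<or> G - ln 3 - of_int t * ln 2 < - (1 / 10 ^ 6)"
  proof (cases "t \<le> u")
    case True
    then have 1: "of_int t * ln 2 \<le> of_int u * ln (2::real)" by (intro mult_right_mono) auto
    have "of_int u * (10 ^ 6 * ln (2::real)) \<le> of_int u * 693147
        \<or> of_int u * (10 ^ 6 * ln (2::real)) \<le> of_int u * 693148"
      by (rule mult_between_le[OF c])
    then have "G - ln 3 - of_int u * ln 2 > 1 / 10 ^ 6"
      using lower[OF u(1)] lower[OF u(2)] ln_3_bounds(2) by auto
    then show ?thesis using 1 by linarith
  next
    case False
    then have "of_int (u + 1) * ln 2 \<le> of_int t * ln (2::real)" by (intro mult_right_mono) auto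
    moreover have "of_int (u + 1) * (10 ^ 6 * ln (2::real)) \<ge> of_int (u + 1) * 693147
        \<or> of_int (u + 1) * (10 ^ 6 * ln (2::real)) \<ge> of_int (u + 1) * 693148"
      by (rule mult_between_ge[OF c])
    then have "G - ln 3 - of_int (u + 1) * ln 2 < - (1 / 10 ^ 6)"
      using upper[OF u(3)] upper[OF u(4)] ln_3_bounds(1) by auto
    ultimately show ?thesis by linarith
  qed
  then show ?thesis unfolding G_def[symmetric] by linarith
qed

text \<open>The list bound 61 is the largest \<open>r\<close> with
  \<open>10 * r <= 21 * s + 30\<close> for \<open>s = 28\<close>, the last case treated
  numerically.\<close>

lemma separated_6_11: "\<forall>s\<in>set [6..<12]. \<forall>r\<in>set [1..61]. 10 * r \<le> 21 * int s + 30 \<longrightarrow> separated s r"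
  by code_simp

lemma separated_12_15: "\<forall>s\<in>set [12..<16]. \<forall>r\<in>set [1..61]. 10 * r \<le> 21 * int s + 30 \<longrightarrow> separated s r"
  by code_simp

lemma separated_16_19: "\<forall>s\<in>set [16..<20]. \<forall>r\<in>set [1..61]. 10 * r \<le> 21 * int s + 30 \<longrightarrow> separated s r"
  by code_simp

lemma separated_20_22: "\<forall>s\<in>set [20..<23]. \<forall>r\<in>set [1..61]. 10 * r \<le> 21 * int s + 30 \<longrightarrow> separated s r"
  by code_simp

lemma separated_23_25: "\<forall>s\<in>set [23..<26]. \<forall>r\<in>set [1..61]. 10 * r \<le> 21 * int s + 30 \<longrightarrow> separated s r"
  by code_simp

lemma separated_26_28: "\<forall>s\<in>set [26..<29]. \<forall>r\<in>set [1..61]. 10 * r \<le> 21 * int s + 30 \<longrightarrow> separated s r"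
  by code_simp

lemma separated_range:
  assumes "6 \<le> s" "s < 29" "1 \<le> r" "10 * r \<le> 21 * int s + 30"
  shows "separated s r"
proof -
  have r: "r \<in> set [1..61]" using assms by simp
  consider "6 \<le> s \<and> s < 12" | "12 \<le> s \<and> s < 16" | "16 \<le> s \<and> s < 20" | "20 \<le> s \<and> s < 23"
    | "23 \<le> s \<and> s < 26" | "26 \<le> s \<and> s < 29"
    using assms(1,2) by linarith
  then show ?thesis
  proof cases
    case 1
    then have "s \<in> set [6..<12]" by (simp only: set_upt atLeastLessThan_iff)
    then show ?thesis using separated_6_11 r assms(4) by blast
  next
    case 2
    then have "s \<in> set [12..<16]" by (simp only: set_upt atLeastLessThan_iff)
    then show ?thesis using separated_12_15 r assms(4) by blast
  next
    case 3
    then have "s \<in> set [16..<20]" by (simp only: set_upt atLeastLessThan_iff)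
    then show ?thesis using separated_16_19 r assms(4) by blast
  next
    case 4
    then have "s \<in> set [20..<23]" by (simp only: set_upt atLeastLessThan_iff)
    then show ?thesis using separated_20_22 r assms(4) by blast
  next
    case 5
    then have "s \<in> set [23..<26]" by (simp only: set_upt atLeastLessThan_iff)
    then show ?thesis using separated_23_25 r assms(4) by blast
  next
    case 6
    then have "s \<in> set [26..<29]" by (simp only: set_upt atLeastLessThan_iff)
    then show ?thesis using separated_26_28 r assms(4) by blast
  qed
qed


section \<open>Powers close to dyadic rationals\<close>
text \<open>Stirling's lower bound for the factorial with 3 in place of \<open>exp 1\<close>, for
  estimating the binomial coefficient in the Pade remainder.\<close>

lemma power_self_le_fact: "n ^ n \<le> 3 ^ n * (fact n :: nat)"
proof (induction n)
  case (Suc n)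
  show ?case
  proof (cases "n = 0")
    case False
    then have "Suc n ^ Suc n \<le> 3 * Suc n * n ^ n" using Suc_power_Suc_le[of n] by simp
    also have "\<dots> \<le> 3 * Suc n * (3 ^ n * fact n)" using Suc.IH by (intro mult_left_mono) auto
    finally show ?thesis by (simp only: power_Suc fact_Suc of_nat_id mult_ac)
  qed simp
qed simp

text \<open>The inequality fails at \<open>h = 14\<close>. With \<open>h = (s + 1) div 2\<close>,
  this is what sets the threshold \<open>s >= 29\<close>.\<close>

lemma quadratic_le_power2:
  assumes "h \<ge> 15"
  shows "96 * h ^ 2 + 48 * h + 1 \<le> (2::nat) ^ h"
  using assms
proof (induction h rule: dec_induct)
  case (step h)
  have "15 * h \<le> h ^ 2" using step(1) by (simp add: power2_eq_square)
  then have "192 * h + 144 \<le> 96 * h ^ 2 + 48 * h + 1" using step(1) by linarith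
  then show ?case using step by (simp add: power2_eq_square algebra_simps)
qed simp

lemma abs_exp_minus_1_le:
  fixes y :: real
  assumes "\<bar>y\<bar> \<le> 1 / 2"
  shows "\<bar>exp y - 1\<bar> \<le> 2 * \<bar>y\<bar>"
proof -
  have "exp y \<le> 1 + 2 * \<bar>y\<bar>" using exp_bound_lemma[of y] assms by simp
  then show ?thesis using exp_ge_add_one_self[of y] by linarith
qed

lemma exp_nat_mult_ln:
  fixes x :: real
  shows "x > 0 \<Longrightarrow> exp (real n * ln x) = x ^ n"
  by (simp add: exp_of_nat_mult)

lemma scaled_dyadic_sum:
  fixes c :: "nat \<Rightarrow> int" and a :: int
  shows "2 ^ (s * d) * (\<Sum>i\<le>d. of_int (c i) * (of_int a / 2 ^ s) ^ i :: real)
    = of_int (\<Sum>i\<le>d. c i * a ^ i * 2 ^ (s * (d - i)))"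
proof -
  have summand: "2 ^ (s * d) * (of_int (c i) * (of_int a / 2 ^ s) ^ i :: real) = of_int (c i * a ^ i * 2 ^ (s * (d - i)))"
    if "i \<le> d" for i
  proof -
    have "(2::real) ^ (s * d) = 2 ^ (s * (d - i)) * (2 ^ s) ^ i"
      using that by (simp flip: power_mult power_add distrib_left)
    then show ?thesis by (simp add: power_divide)
  qed
  show ?thesis unfolding sum_distrib_left of_int_sum
    by (intro sum.cong refl summand) simp
qed

lemma abs_pade_num_le:
  assumes "i \<le> d"
  shows "\<bar>pade_num m d i\<bar> \<le> int (m + 2 * d + 1) ^ d"
proof -
  have "((m + i) choose i) \<le> (m + i) ^ i" by (rule binomial_le_pow) simp
  also have "\<dots> \<le> (m + 2 * d + 1) ^ i" using assms by (intro power_mono) auto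
  finally have 1: "((m + i) choose i) \<le> (m + 2 * d + 1) ^ i" .
  have 2: "((m + 2 * d + 1) choose (d - i)) \<le> (m + 2 * d + 1) ^ (d - i)"
    by (rule binomial_le_pow) simp
  have "((m + i) choose i) * ((m + 2 * d + 1) choose (d - i)) \<le> (m + 2 * d + 1) ^ i * (m + 2 * d + 1) ^ (d - i)"
    using 1 2 by (rule mult_le_mono)
  also have "\<dots> = (m + 2 * d + 1) ^ d" using assms by (simp only: power_add[symmetric] le_add_diff_inverse)
  finally have "int (((m + i) choose i) * ((m + 2 * d + 1) choose (d - i))) \<le> int ((m + 2 * d + 1) ^ d)"
    by (simp only: of_nat_le_iff)
  then show ?thesis by (simp only: pade_num_def abs_mult power_abs abs_neg_one power_one mult_1_left
      of_nat_mult of_nat_power abs_of_nat)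
qed

text \<open>
  Here \<open>A = (k / 2 ^ s) ^ k\<close> is close to \<open>g = A * exp (- L)\<close>, and \<open>2 ^ (3 * s) * g\<close> is an integer.
  For the approximants \<open>U\<close>, \<open>V\<close> of degree \<open>d\<close>, the integer \<open>Y = 2 ^ (s * d + 3 * s) * (g * U - V)\<close>
  lies strictly between 0 and 1. The remainder \<open>A * U - V\<close> is about
  \<open>(e * r / (2 * d)) ^ (2 * d)\<close>, so it beats the denominator \<open>2 ^ (s * d)\<close> as soon as \<open>d\<close>
  exceeds a multiple of \<open>s * 2 ^ (s / 2)\<close>, while \<open>L\<close> is negligible as long as \<open>s * d\<close> is small
  compared with \<open>k\<close>.
\<close>

lemma no_close_power_near_dyadic:
  fixes s k r :: nat and t :: int
  assumes s: "s \<ge> 29" and k: "k = 2 ^ s + r" and r: "1 \<le> r" "10 * r \<le> 21 * s + 30"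
  defines "L \<equiv> real k * ln (real k / 2 ^ s) - 2 * ln ((real k - 1) / 2 ^ s) - ln 3 - of_int t * ln 2"
  assumes L: "\<bar>L\<bar> \<le> real k ^ 2 / 2 ^ k"
  shows False
proof -
  \<comment> \<open>Rounding \<open>s / 2\<close> up makes \<open>2 ^ (2 * h * d)\<close> at least
    \<open>2 ^ (s * d)\<close>. The factor \<open>4 * s\<close> in \<open>d\<close> is chosen so
    that \<open>3 * (k + d) * z\<close>, at most \<open>15 / 2 * s\<close>, stays below
    \<open>15 / 16 * D / 2 ^ h\<close>; the constant below 1 pays for the remaining factors.\<close>
  define h where "h = (s + 1) div 2"
  define d where "d = 4 * s * 2 ^ h"
  define D where "D = 2 * d + 1"
  define m where "m = k - d - 1"
  have h: "s \<le> 2 * h" "2 * h \<le> s + 1" "h \<ge> 15" using s by (auto simp: h_def)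
  have quad: "96 * h ^ 2 + 48 * h + 1 \<le> (2::nat) ^ h" using h(3) by (rule quadratic_le_power2)
  \<comment> \<open>The exponents of 2 in the estimate of \<open>(g - A) * U * D ^ D\<close>:
    \<open>2 * s + 3\<close> from \<open>2 * \<epsilon>\<close>, \<open>4 * s\<close> from
    \<open>A\<close>, \<open>(s + 3) * d\<close> from \<open>U\<close>, and
    \<open>2 * h * (2 * d + 2)\<close> from \<open>D ^ (2 * d + 2)\<close>. The sum must stay below
    \<open>k\<close> for the factor \<open>2 ^ (- k)\<close> in \<open>\<epsilon>\<close> to
    win.\<close>
  have key: "6 * s + 3 + (s + 3) * d + 2 * h * (2 * d + 2) < 2 ^ s"
  proof -
    let ?H = "(2::nat) ^ h"
    have sq: "?H * ?H \<le> 2 * 2 ^ s"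
      using h(2) by (simp flip: power_add power_Suc add: mult_2[symmetric])
    have "d \<le> 8 * h * ?H" using h(1) by (simp add: d_def)
    then have "(s + 3 + 4 * h) * d \<le> (6 * h + 3) * (8 * h * ?H)"
      using h(1) by (intro mult_le_mono) auto
    then have "2 * (6 * s + 3 + (s + 3) * d + 2 * h * (2 * d + 2)) \<le> 32 * h + 6 + 16 * h * (6 * h + 3) * ?H"
      using h(1) by (simp add: algebra_simps)
    also have "32 * h + 6 < ?H"
    proof -
      have "15 * h \<le> h ^ 2" using h(3) by (simp add: power2_eq_square)
      then show ?thesis using quad h(3) by linarith
    qed
    also have "?H + 16 * h * (6 * h + 3) * ?H = (96 * h ^ 2 + 48 * h + 1) * ?H"
      by (simp add: power2_eq_square algebra_simps)
    also have "\<dots> \<le> ?H * ?H" using quad by (rule mult_le_mono1)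
    also note sq
    finally show ?thesis by simp
  qed
  have d_big: "d \<ge> 64 * s"
  proof -
    have "(2::nat) ^ 15 \<le> 2 ^ h" using h(3) by (rule power_increasing) simp
    then have "64 * s \<le> 4 * s * 2 ^ h" by simp
    then show ?thesis by (simp add: d_def)
  qed
  have d10: "10 * d + 10 * r \<le> 2 ^ s"
  proof -
    have "32 * d \<le> (s + 3) * d" using s by (intro mult_right_mono) auto
    then show ?thesis using key r(2) d_big s by linarith
  qed
  have dk: "d + 1 \<le> k" using d10 r by (simp add: k)
  then have md: "m + d + 1 = k" "m + 2 * d + 1 = k + d" by (auto simp: m_def)
  have k2: "real k \<le> 2 ^ (s + 1)"
  proof -
    have "k \<le> 2 ^ (s + 1)" using d10 by (simp add: k)
    then have "real k \<le> real (2 ^ (s + 1))" by (simp only: of_nat_le_iff)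
    then show ?thesis by simp
  qed
  have "2 ^ s \<le> k" by (simp add: k)
  define z where "z = real r / 2 ^ s"
  define x where "x = real k / 2 ^ s"
  have x: "x = 1 + z" by (simp add: x_def z_def k add_divide_distrib)
  have z: "z \<ge> 1 / 2 ^ s" using r(1) by (simp add: z_def divide_right_mono)
  have "z \<ge> 0" by (simp add: z_def)
  have x2: "1 \<le> x" "x \<le> 2" using \<open>z \<ge> 0\<close> k2 by (simp add: x, simp add: x_def divide_le_eq)
  define A where "A = x ^ k"
  have A1: "A \<ge> 1" unfolding A_def using x2(1) by (rule one_le_power)
  have kz: "10 * (real (k + d) * z) \<le> 11 * real r"
  proof -
    have "10 * real (k + d) \<le> 11 * 2 ^ s"
    proof -
      have "10 * (k + d) \<le> 11 * 2 ^ s" using d10 by (simp add: k)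
      then have "real (10 * (k + d)) \<le> real (11 * 2 ^ s)" by (simp only: of_nat_le_iff)
      then show ?thesis by simp
    qed
    then have "10 * real (k + d) * real r \<le> 11 * 2 ^ s * real r" by (intro mult_right_mono) auto
    then show ?thesis by (simp add: z_def field_simps)
  qed
  have "real (10 * r) \<le> real (21 * s + 30)" using r(2) by (simp only: of_nat_le_iff)
  then have r_real: "10 * real r \<le> 21 * real s + 30" by simp
  have A_upper: "A \<le> 2 ^ (4 * s)"
  proof -
    have "real k * ln x \<le> real k * z"
      using ln_add_one_self_le_self[OF \<open>z \<ge> 0\<close>] by (intro mult_left_mono) (auto simp: x)
    also have "\<dots> \<le> real (k + d) * z" using \<open>z \<ge> 0\<close> by (intro mult_right_mono) auto
    also have "\<dots> \<le> 4 * real s * (2 / 3)" using kz r_real s by simp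
    also have "\<dots> \<le> 4 * real s * ln 2" using ln2_ge_two_thirds by (intro mult_left_mono) auto
    finally have "exp (real k * ln x) \<le> exp (real (4 * s) * ln 2)" by simp
    then show ?thesis using x2 exp_nat_mult_ln[of x k] exp_nat_mult_ln[of 2 "4 * s"] by (simp add: A_def)
  qed
  define \<epsilon> where "\<epsilon> = (2::real) ^ (2 * s + 2) / 2 ^ k"
  have L\<epsilon>: "\<bar>L\<bar> \<le> \<epsilon>"
  proof -
    have "real k ^ 2 \<le> (2 ^ (s + 1)) ^ 2" using k2 by (intro power_mono) auto
    also have "\<dots> = 2 ^ (2 * s + 2)" by (simp flip: power_mult add: algebra_simps)
    finally have "real k ^ 2 / 2 ^ k \<le> \<epsilon>" unfolding \<epsilon>_def by (intro divide_right_mono) auto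
    with L show ?thesis by linarith
  qed
  have pow_lt: "(2::real) ^ a / 2 ^ k * 2 \<le> 1" if "a < 2 ^ s" for a
  proof -
    have "(2::real) ^ (a + 1) \<le> 2 ^ k" using that \<open>2 ^ s \<le> k\<close> by (intro power_increasing) auto
    then show ?thesis by simp
  qed
  have \<epsilon>_half: "\<epsilon> \<le> 1 / 2" using pow_lt[of "2 * s + 2"] key by (simp add: \<epsilon>_def)
  define g where "g = A * exp (- L)"
  have gA: "\<bar>g - A\<bar> \<le> 2 * \<epsilon> * 2 ^ (4 * s)"
  proof -
    have "g - A = A * (exp (- L) - 1)" by (simp add: g_def algebra_simps)
    then have "\<bar>g - A\<bar> = A * \<bar>exp (- L) - 1\<bar>" using A1 by (simp add: abs_mult)
    also have "\<dots> \<le> 2 ^ (4 * s) * (2 * \<epsilon>)"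
      using abs_exp_minus_1_le[of "- L"] L\<epsilon> \<epsilon>_half A1 A_upper by (intro mult_mono) auto
    finally show ?thesis by (simp add: mult_ac)
  qed
  \<comment> \<open>Of the factor \<open>2 ^ (3 * s)\<close> that makes \<open>g\<close> an integer,
    two thirds clear the square of \<open>(k - 1) / 2 ^ s\<close>. The last \<open>2 ^ s\<close>
    absorbs a possibly negative \<open>t\<close>, hence the need for
    \<open>t >= - s\<close>.\<close>
  have k1: "real k - 1 > 0" using dk d_big s by simp
  have t_ge: "t + int s \<ge> 0"
  proof -
    have "ln ((real k - 1) / 2 ^ s) \<le> ln 2"
      using k1 x2(2) by (subst ln_le_cancel_iff) (auto simp: x_def field_simps)
    moreover have "real k * ln (real k / 2 ^ s) \<ge> 0" using x2(1) by (simp flip: x_def)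
    moreover have "ln (3::real) \<le> 2 * ln 2"
    proof -
      have "ln (3::real) \<le> ln 4" by (subst ln_le_cancel_iff) auto
      also have "\<dots> = 2 * ln 2" using ln_realpow[of 2 2] by simp
      finally show ?thesis .
    qed
    ultimately have "of_int t * ln 2 \<ge> - 4 * ln 2 - (1::real)" using L\<epsilon> \<epsilon>_half unfolding L_def by linarith
    then have "(of_int t + 6) * ln (2::real) \<ge> 2 * ln 2 - 1" by (simp add: algebra_simps)
    then have "0 < (of_int t + 6) * ln (2::real)" using ln2_ge_two_thirds by linarith
    then have "of_int t + 6 > (0::real)" by (simp add: zero_less_mult_iff)
    then show ?thesis using s by linarith
  qed
  define T where "T = nat (t + int s)"
  have g_int: "2 ^ (3 * s) * g = of_int (3 * (int k - 1) ^ 2 * 2 ^ T)"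
  proof -
    have "A = exp (real k * ln (real k / 2 ^ s))" using x2 exp_nat_mult_ln[of x k] by (simp add: A_def flip: x_def)
    then have "g = exp (real k * ln (real k / 2 ^ s) + - L)"
      unfolding g_def by (simp only: exp_add)
    also have "real k * ln (real k / 2 ^ s) + - L = 2 * ln ((real k - 1) / 2 ^ s) + ln 3 + of_int t * ln 2"
      by (simp add: L_def)
    also have "exp (2 * ln ((real k - 1) / 2 ^ s) + ln 3 + of_int t * ln 2) = ((real k - 1) / 2 ^ s) ^ 2 * 3 * exp (of_int t * ln 2)"
      using k1 exp_nat_mult_ln[of "(real k - 1) / 2 ^ s" 2] by (simp add: exp_add)
    finally have g: "g = ((real k - 1) / 2 ^ s) ^ 2 * 3 * exp (of_int t * ln 2)" .
    have "exp (of_int t * ln 2) * 2 ^ s = exp (of_int t * ln 2) * exp (real s * ln 2)"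
      using exp_nat_mult_ln[of 2 s] by simp
    also have "\<dots> = exp (real T * ln 2)"
      using t_ge by (simp add: T_def algebra_simps flip: exp_add)
    also have "\<dots> = 2 ^ T" by (rule exp_nat_mult_ln) simp
    finally have "exp (of_int t * ln 2) * 2 ^ s = (2::real) ^ T" .
    moreover have "2 ^ (3 * s) * g = (real k - 1) ^ 2 * 3 * (exp (of_int t * ln 2) * 2 ^ s)"
    proof -
      have "(2::real) ^ (3 * s) = (2 ^ s) ^ 2 * 2 ^ s" by (simp flip: power_mult power_add add: mult.commute)
      then show ?thesis unfolding g by (simp add: power_divide)
    qed
    ultimately show ?thesis by simp
  qed
  define U where "U = (\<Sum>i\<le>d. of_int (pade_num m d i) * (of_int (int k) / 2 ^ s) ^ i :: real)"
  define V where "V = (\<Sum>i\<le>d. of_int (pade_rem m d i) * (of_int (int r) / 2 ^ s) ^ i :: real)"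
  define C where "C = real ((k + d) choose D)"
  define E where "E = x ^ k * U - V"
  have E: "C * z ^ D \<le> E" "E \<le> C * z ^ D * A"
  proof -
    have *: "(1 + z) ^ (m + d + 1) * (\<Sum>i\<le>d. of_int (pade_num m d i) * (1 + z) ^ i)
                - (\<Sum>n\<le>d. of_int (pade_rem m d n) * z ^ n) = E"
      unfolding E_def U_def V_def md(1) x[symmetric] by (simp add: x_def z_def)
    note b = pade_binomial[OF \<open>z \<ge> 0\<close>, of m d, unfolded * md(2), folded D_def C_def x]
    show "C * z ^ D \<le> E" using b(1) .
    have "x ^ m \<le> A" unfolding A_def using x2(1) by (intro power_increasing) (auto simp: m_def)
    then have "C * z ^ D * x ^ m \<le> C * z ^ D * A"
      using \<open>z \<ge> 0\<close> by (intro mult_left_mono) (auto simp: C_def)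
    with b(2) show "E \<le> C * z ^ D * A" by linarith
  qed
  define N :: real where "N = 2 ^ (s * d + 3 * s)"
  have N: "N > 0" by (simp add: N_def)
  have D_pow: "real D \<le> 2 ^ (2 * h)"
  proof -
    have "8 * s + 1 \<le> (2::nat) ^ h"
    proof -
      have "15 * h \<le> h ^ 2" using h(3) by (simp add: power2_eq_square)
      then show ?thesis using quad h(1,3) by linarith
    qed
    then have "(8 * s + 1) * 2 ^ h \<le> (2::nat) ^ h * 2 ^ h" by (rule mult_le_mono1)
    moreover have "D \<le> (8 * s + 1) * 2 ^ h" by (simp add: D_def d_def)
    ultimately have "D \<le> 2 ^ h * 2 ^ h" by linarith
    then have "real D \<le> real (2 ^ h * 2 ^ h)" by (simp only: of_nat_le_iff)
    then show ?thesis by (simp flip: power_add add: mult_2)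
  qed
  have D1: "real D \<ge> 1" by (simp add: D_def)
  \<comment> \<open>This uses \<open>r >= 1\<close>: then \<open>z >= 1 / 2 ^ s\<close>, so
    \<open>(k + d) * z >= 1\<close>. Compared with \<open>err\<close>, it shows that the
    perturbation of \<open>A\<close> to \<open>g\<close> cannot cancel the remainder.\<close>
  have lower: "1 / real D ^ D \<le> C * z ^ D"
  proof -
    have "(real (k + d) / real D) ^ D \<le> C" unfolding C_def
      by (rule binomial_ge_n_over_k_pow_k) (use dk in \<open>simp add: D_def\<close>)
    then have "(real (k + d) / real D) ^ D * z ^ D \<le> C * z ^ D"
      using \<open>z \<ge> 0\<close> by (intro mult_right_mono) auto
    moreover have "1 / real D \<le> real (k + d) / real D * z"
    proof -
      have "1 \<le> real k * (1 / 2 ^ s)" by (simp add: k field_simps)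
      also have "\<dots> \<le> real (k + d) * z" using z by (intro mult_mono) auto
      finally show ?thesis using D1 by (simp add: field_simps)
    qed
    then have "(1 / real D) ^ D \<le> (real (k + d) / real D * z) ^ D" by (intro power_mono) auto
    ultimately show ?thesis unfolding power_mult_distrib[symmetric] by (simp add: power_divide)
  qed
  have U_bound: "\<bar>U\<bar> \<le> real D * 2 ^ ((s + 3) * d)"
  proof -
    have "\<bar>U\<bar> \<le> (\<Sum>i\<le>d. \<bar>of_int (pade_num m d i) * (of_int (int k) / 2 ^ s) ^ i :: real\<bar>)"
      unfolding U_def by (rule sum_abs)
    also have "\<dots> \<le> (\<Sum>i\<le>d. (2 ^ (s + 3)) ^ d)"
    proof (intro sum_mono)
      fix i assume i: "i \<in> {..d}"
      have "real_of_int \<bar>pade_num m d i\<bar> \<le> of_int (int (m + 2 * d + 1) ^ d)"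
        using i by (simp only: of_int_le_iff) (rule abs_pade_num_le, simp)
      also have "\<dots> = real (k + d) ^ d" unfolding md(2) by simp
      also have "\<dots> \<le> (2 ^ (s + 2)) ^ d" using dk k2 by (intro power_mono) auto
      finally have 1: "\<bar>real_of_int (pade_num m d i)\<bar> \<le> (2 ^ (s + 2)) ^ d" by simp
      have "x ^ i \<le> x ^ d" using i x2(1) by (intro power_increasing) auto
      also have "\<dots> \<le> 2 ^ d" using x2 by (intro power_mono) auto
      finally have "\<bar>real_of_int (pade_num m d i)\<bar> * x ^ i \<le> (2 ^ (s + 2)) ^ d * 2 ^ d"
        using 1 x2 by (intro mult_mono) auto
      also have "\<dots> = (2 ^ (s + 2) * 2) ^ d" by (rule power_mult_distrib[symmetric])
      also have "(2::real) ^ (s + 2) * 2 = 2 ^ (s + 3)" by (simp add: power_add)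
      finally show "\<bar>of_int (pade_num m d i) * (of_int (int k) / 2 ^ s) ^ i :: real\<bar> \<le> (2 ^ (s + 3)) ^ d"
        using x2 by (simp add: abs_mult power_abs x_def)
    qed
    also have "\<dots> = real (d + 1) * (2 ^ (s + 3)) ^ d" by simp
    also have "\<dots> \<le> real D * 2 ^ ((s + 3) * d)"
      unfolding power_mult by (intro mult_right_mono) (auto simp: D_def)
    finally show ?thesis .
  qed
  have err: "\<bar>(g - A) * U\<bar> < C * z ^ D"
  proof -
    have "\<bar>(g - A) * U\<bar> \<le> (2 * \<epsilon> * 2 ^ (4 * s)) * (real D * 2 ^ ((s + 3) * d))"
      unfolding abs_mult using gA U_bound by (intro mult_mono) (auto simp: \<epsilon>_def)
    also have "\<dots> < 1 / real D ^ D"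
    proof -
      have "(2 * \<epsilon> * 2 ^ (4 * s)) * (real D * 2 ^ ((s + 3) * d)) * real D ^ D
          = 2 * \<epsilon> * 2 ^ (4 * s) * 2 ^ ((s + 3) * d) * real D ^ (2 * d + 2)"
      proof -
        have "2 * d + 2 = Suc D" by (simp add: D_def)
        then show ?thesis by (simp only: power_Suc mult_ac)
      qed
      also have "\<dots> \<le> 2 * \<epsilon> * 2 ^ (4 * s) * 2 ^ ((s + 3) * d) * (2 ^ (2 * h)) ^ (2 * d + 2)"
        using D_pow by (intro mult_left_mono power_mono) (auto simp: \<epsilon>_def)
      also have "\<dots> = 2 ^ (6 * s + 3 + (s + 3) * d + 2 * h * (2 * d + 2)) / 2 ^ k"
      proof -
        have e: "6 * s + 3 + (s + 3) * d + 2 * h * (2 * d + 2)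
            = 1 + (2 * s + 2) + 4 * s + (s + 3) * d + 2 * h * (2 * d + 2)" by simp
        show ?thesis
          unfolding e power_add[of _ _ "2 * h * (2 * d + 2)"] power_add[of _ _ "(s + 3) * d"]
            power_add[of _ _ "4 * s"] power_add[of _ 1] power_mult[of _ "2 * h"] \<epsilon>_def power_one_right
          by (simp only: times_divide_eq_left times_divide_eq_right mult_ac)
      qed
      also have "\<dots> < 1"
      proof -
        have "y < 1" if "y * 2 \<le> 1" for y :: real using that by linarith
        then show ?thesis using pow_lt[OF key] by blast
      qed
      finally show ?thesis using D1 by (simp add: field_simps)
    qed
    also note lower
    finally show ?thesis .
  qed
  have upper: "N * (C * z ^ D * A) \<le> 1 / 2"
  proof -
    have "real (((k + d) choose D) * fact D) \<le> real ((k + d) ^ D)"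
      by (simp only: of_nat_le_iff binomial_fact_pow)
    then have C: "C * fact D \<le> real (k + d) ^ D" by (simp add: C_def)
    have "real (D ^ D) \<le> real (3 ^ D * fact D)" by (simp only: of_nat_le_iff power_self_le_fact)
    then have F: "real D ^ D \<le> 3 ^ D * fact D" by simp
    have "C * z ^ D * real D ^ D \<le> C * z ^ D * (3 ^ D * fact D)"
      using F \<open>z \<ge> 0\<close> by (intro mult_left_mono) (auto simp: C_def)
    also have "\<dots> = C * fact D * (3 * z) ^ D" by (simp add: power_mult_distrib)
    also have "\<dots> \<le> real (k + d) ^ D * (3 * z) ^ D" using C \<open>z \<ge> 0\<close> by (intro mult_right_mono) auto
    also have "\<dots> = (3 * (real (k + d) * z)) ^ D" by (simp add: power_mult_distrib)
    also have "\<dots> \<le> (15 / 16 / 2 ^ h * real D) ^ D"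
    proof (rule power_mono)
      have "29 \<le> real s" using s by simp
      then have "3 * (real (k + d) * z) \<le> 15 / 2 * real s" using kz r_real by linarith
      also have "\<dots> = 15 / 16 / 2 ^ h * (8 * real s * 2 ^ h)" by simp
      also have "\<dots> \<le> 15 / 16 / 2 ^ h * real D"
        by (intro mult_left_mono) (auto simp: D_def d_def)
      finally show "3 * (real (k + d) * z) \<le> 15 / 16 / 2 ^ h * real D" .
    qed (use \<open>z \<ge> 0\<close> in simp)
    finally have "C * z ^ D * real D ^ D \<le> (15 / 16 / 2 ^ h) ^ D * real D ^ D"
      by (simp only: power_mult_distrib)
    then have "C * z ^ D \<le> (15 / 16 / 2 ^ h) ^ D"
      by (rule mult_right_le_imp_le) (use D1 in simp)
    then have Cz: "C * z ^ D \<le> (15 / 16) ^ D / 2 ^ (h * D)"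
      by (simp add: power_divide power_mult)
    \<comment> \<open>Since \<open>(15 / 16) ^ 16 <= 1 / 2\<close> and \<open>D >= 128 * s\<close>,
      the spare factor gains \<open>2 ^ (8 * s)\<close>, more than the \<open>2 ^ (7 * s)\<close>
      lost to \<open>2 ^ (3 * s)\<close> and \<open>A\<close>.\<close>
    have "(15 / 16 :: real) ^ D \<le> (15 / 16) ^ (16 * (8 * s))"
      using d_big by (intro power_decreasing) (auto simp: D_def)
    also have "\<dots> = ((15 / 16) ^ 16) ^ (8 * s)" by (rule power_mult)
    also have "\<dots> \<le> (1 / 2) ^ (8 * s)" by (intro power_mono) (auto simp: power_divide)
    finally have "(15 / 16 :: real) ^ D \<le> 1 / 2 ^ (8 * s)" by (simp add: power_divide)
    then have "C * z ^ D \<le> 1 / 2 ^ (8 * s) / 2 ^ (h * D)"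
      using Cz by (meson divide_right_mono order_trans zero_le_numeral zero_le_power)
    also have "\<dots> \<le> 1 / 2 ^ (8 * s) / 2 ^ (s * d)"
    proof -
      have "s * d \<le> 2 * h * d" using h(1) by (intro mult_right_mono) auto
      moreover have "h * D = 2 * h * d + h" by (simp add: D_def)
      ultimately have "s * d \<le> h * D" by linarith
      then have "(2::real) ^ (s * d) \<le> 2 ^ (h * D)" by (intro power_increasing) auto
      then show ?thesis by (intro divide_left_mono) auto
    qed
    finally have "N * (C * z ^ D * A) \<le> N * (1 / 2 ^ (8 * s) / 2 ^ (s * d) * 2 ^ (4 * s))"
      using A1 A_upper N by (intro mult_left_mono mult_mono) auto
    also have "\<dots> = (2 ^ (3 * s) * 2 ^ (4 * s)) / 2 ^ (8 * s)"
      by (simp add: N_def power_add)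
    also have "(2::real) ^ (3 * s) * 2 ^ (4 * s) = 2 ^ (7 * s)" by (simp flip: power_add)
    also have "(2::real) ^ (7 * s) / 2 ^ (8 * s) \<le> 1 / 2"
    proof -
      have half: "y / w \<le> 1 / 2" if "y * 2 \<le> w" "w > 0" for y w :: real
        using that by (simp add: field_simps)
      have "(2::real) ^ (7 * s + 1) \<le> 2 ^ (8 * s)" using s by (intro power_increasing) auto
      then show ?thesis by (intro half) (simp_all only: power_add power_one_right zero_less_power zero_less_numeral)
    qed
    finally show ?thesis .
  qed
  define Y where "Y = 3 * (int k - 1) ^ 2 * 2 ^ T * (\<Sum>i\<le>d. pade_num m d i * int k ^ i * 2 ^ (s * (d - i)))
      - 2 ^ (3 * s) * (\<Sum>i\<le>d. pade_rem m d i * int r ^ i * 2 ^ (s * (d - i)))"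
  have "real_of_int Y = (2 ^ (3 * s) * g) * (2 ^ (s * d) * U) - 2 ^ (3 * s) * (2 ^ (s * d) * V)"
    unfolding Y_def U_def V_def scaled_dyadic_sum g_int by simp
  also have "\<dots> = N * (E + (g - A) * U)"
    unfolding N_def E_def A_def power_add by (simp add: algebra_simps)
  finally have Y: "real_of_int Y = N * (E + (g - A) * U)" .
  have "E + (g - A) * U > 0" using err E(1) by linarith
  then have "real_of_int Y > 0" unfolding Y using N by simp
  moreover have "real_of_int Y < 1"
  proof -
    have "C * z ^ D \<le> C * z ^ D * A"
      using mult_left_mono[OF A1, of "C * z ^ D"] \<open>z \<ge> 0\<close> by (simp add: C_def)
    then have "E + (g - A) * U < 2 * (C * z ^ D * A)" using err E(2) by linarith
    then have "N * (E + (g - A) * U) < N * (2 * (C * z ^ D * A))" using N by (rule mult_strict_left_mono)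
    then show ?thesis unfolding Y using upper by linarith
  qed
  ultimately show False by simp
qed


section \<open>Divisibility and small parameters\<close>

lemma odd_abs_disc:
  assumes "even k" "d * (int k - 1)\<^sup>2 = disc_num k"
  shows "odd d"
proof -
  have "odd (disc_num k)" using assms(1) by (simp add: disc_num_def)
  then show ?thesis unfolding assms(2)[symmetric] by simp
qed

text \<open>For \<open>k = 2 * y + 1\<close> both terms of \<open>disc_num\<close> contain
  \<open>2 ^ (k + 1)\<close>. In the cofactor \<open>W\<close> the constant and linear terms in
  \<open>y\<close> cancel modulo \<open>y ^ 2\<close>, so dividing by
  \<open>(k - 1) ^ 2 = 4 * y ^ 2\<close> costs only two factors of 2.\<close>

lemma power2_dvd_abs_disc:
  assumes "odd k" "k \<ge> 3" "d * (int k - 1)\<^sup>2 = disc_num k"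
  shows "2 ^ (k - 1) dvd d"
proof -
  obtain y where y: "k = 2 * y + 1" using assms(1) by (rule oddE)
  have "y \<ge> 1" using y assms(2) by simp
  define Y where "Y = int y"
  define W where "W = (1 + 2 * Y) ^ (2 * y + 1) - (1 + Y) ^ (2 * y + 2)"
  have "Y\<^sup>2 dvd (2 * Y)\<^sup>2" by (simp add: power_mult_distrib)
  then have 1: "Y\<^sup>2 dvd (1 + 2 * Y) ^ (2 * y + 1) - (1 + int (2 * y + 1) * (2 * Y))"
    using binomial_cong_square dvd_trans by blast
  have 2: "Y\<^sup>2 dvd (1 + Y) ^ (2 * y + 2) - (1 + int (2 * y + 2) * Y)"
    by (rule binomial_cong_square)
  have "W = ((1 + 2 * Y) ^ (2 * y + 1) - (1 + int (2 * y + 1) * (2 * Y)))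
      - ((1 + Y) ^ (2 * y + 2) - (1 + int (2 * y + 2) * Y)) + Y\<^sup>2 * 2"
    by (simp add: W_def Y_def power2_eq_square algebra_simps)
  then have "Y\<^sup>2 dvd W" using 1 2 by (simp only: dvd_add dvd_diff dvd_triv_left)
  then obtain w where w: "W = Y\<^sup>2 * w" by (rule dvdE)
  have "(int k + 1) ^ (k + 1) = (2 * (1 + Y)) ^ (2 * y + 2)" by (simp add: y Y_def algebra_simps)
  also have "\<dots> = 2 ^ (2 * y + 2) * (1 + Y) ^ (2 * y + 2)" by (rule power_mult_distrib)
  finally have "disc_num k = 2 ^ (2 * y + 2) * W"
    unfolding disc_num_def W_def by (simp add: y Y_def algebra_simps)
  moreover have "d * (int k - 1)\<^sup>2 = 4 * Y\<^sup>2 * d" by (simp add: y Y_def power_mult_distrib)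
  ultimately have "4 * Y\<^sup>2 * d = 2 ^ (2 * y + 2) * (Y\<^sup>2 * w)"
    using assms(3) unfolding w by (simp only:)
  also have "\<dots> = 4 * Y\<^sup>2 * (2 ^ (2 * y) * w)" by (simp add: power_add)
  finally have "4 * Y\<^sup>2 * d = 4 * Y\<^sup>2 * (2 ^ (2 * y) * w)" .
  moreover have "4 * Y\<^sup>2 \<noteq> 0" using \<open>y \<ge> 1\<close> by (simp add: Y_def)
  ultimately have "d = 2 ^ (2 * y) * w" by (simp only: mult_cancel_left) blast
  then show ?thesis by (simp add: y)
qed

lemma lucas_neq_between:
  assumes "k \<ge> 2" "e \<ge> 2" "lucas k e < d" "d < lucas k (Suc e)"
  shows "lucas k n \<noteq> d"
proof -
  have "lucas k n \<le> lucas k e" if "n \<le> e"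
  proof (cases "n = 0")
    case True
    have "lucas k 2 \<le> lucas k e" using assms by (intro lucas_mono) auto
    then show ?thesis using True lucas_2[OF assms(1)] by simp
  qed (use that assms in \<open>auto intro: lucas_mono\<close>)
  moreover have "lucas k (Suc e) \<le> lucas k n" if "\<not> n \<le> e"
    using that assms(1) by (intro lucas_mono) auto
  ultimately show ?thesis using assms by (cases "n \<le> e") auto
qed

text \<open>With denominators cleared, the discriminant exceeds the upper bound for
  \<open>lucas k (e - 1)\<close> and stays below the lower bound for \<open>lucas k e\<close>. No
  Lucas number has to be evaluated.\<close>

definition small_separated :: "nat \<Rightarrow> nat \<Rightarrow> bool" where
  "small_separated k e \<longleftrightarrow> e \<ge> 3
     \<and> 3 * 2 ^ (e - 1) * (int k - 1)\<^sup>2 < 4 * disc_num k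
     \<and> 4 * disc_num k * 2 ^ (k + 1) < 3 * 2 ^ e * (2 ^ (k + 1) - int e) * (int k - 1)\<^sup>2"

lemma small_separated_imp:
  assumes "small_separated k e" "k \<ge> 2" "d * (int k - 1)\<^sup>2 = disc_num k"
  shows "lucas k n \<noteq> d"
proof (rule lucas_neq_between[of k "e - 1"])
  have e: "e \<ge> 3" using assms(1) by (simp add: small_separated_def)
  then show "e - 1 \<ge> 2" by simp
  have pos: "(int k - 1)\<^sup>2 > 0" using assms(2) by simp
  have "3 * 2 ^ (e - 1) * (int k - 1)\<^sup>2 < 4 * d * (int k - 1)\<^sup>2"
    using assms(1) unfolding small_separated_def assms(3)[symmetric] by (simp add: mult.assoc)
  then have "3 * 2 ^ (e - 1) < 4 * d" using pos by (simp only: mult_less_cancel_right_pos)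
  moreover have "4 * lucas k (e - 1) \<le> 3 * 2 ^ (e - 1)" using e assms(2) by (intro lucas_upper) auto
  ultimately show "lucas k (e - 1) < d" by linarith
  have "4 * d * 2 ^ (k + 1) * (int k - 1)\<^sup>2 < 3 * 2 ^ e * (2 ^ (k + 1) - int e) * (int k - 1)\<^sup>2"
    using assms(1) unfolding small_separated_def assms(3)[symmetric] by (simp add: mult_ac)
  then have "4 * d * 2 ^ (k + 1) < 3 * 2 ^ e * (2 ^ (k + 1) - int e)"
    using pos by (simp only: mult_less_cancel_right_pos)
  also have "\<dots> \<le> 4 * 2 ^ (k + 1) * lucas k e" using lucas_lower[of e k] e assms(2) by simp
  finally have "4 * 2 ^ (k + 1) * d < 4 * 2 ^ (k + 1) * lucas k e" by (simp only: mult_ac)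
  then show "d < lucas k (Suc (e - 1))" using e by simp
qed (use assms in auto)

text \<open>
  Entry \<open>e\<close> of the list is the exponent with \<open>3 * 2 ^ (e - 1) < 4 * d < 3 * 2 ^ e\<close>, where \<open>d\<close> is the
  absolute value of the discriminant.
\<close>

lemma small_separated_5_63:
  "list_all2 small_separated [5..<64]
     [14, 19, 23, 28, 33, 39, 44, 50, 56, 62, 68, 74, 80, 87, 93,
      100, 107, 113, 120, 127, 134, 141, 148, 155, 162, 169, 177, 184, 191, 199,
      206, 214, 221, 229, 237, 244, 252, 260, 267, 275, 283, 291, 299, 307, 315,
      323, 331, 339, 347, 355, 363, 372, 380, 388, 396, 405, 413, 421, 430]"
  by code_simp

text \<open>For \<open>k\<close> = 2, 3, 4 the relative error \<open>e / 2 ^ (k + 1)\<close> is too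
  large and no \<open>e\<close> satisfies \<open>small_separated\<close>, so the neighbouring terms
  are computed.\<close>

lemma lucas_neq_disc_small:
  assumes "2 \<le> k" "k < 64" "d * (int k - 1)\<^sup>2 = disc_num k"
  shows "lucas k n \<noteq> d"
proof -
  consider "k = 2" | "k = 3" | "k = 4" | "k \<ge> 5" using assms(1) by linarith
  then show ?thesis
  proof cases
    case 1
    have d: "d = 5" using assms(3) by (simp add: 1 disc_num_def eval_nat_numeral)
    have "lucas 2 (Suc 2) = 4" using lucas_rec[of 2 2] lucas_2[of 2] by simp
    then have "lucas 2 3 = 4" by simp
    moreover from this have "lucas 2 (Suc 3) = 7" using lucas_rec[of 3 2] by simp
    ultimately show ?thesis unfolding 1 d by (intro lucas_neq_between[of 2 3]) auto
  next
    case 2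
    have d: "d = 44" using assms(3) by (simp add: 2 disc_num_def eval_nat_numeral)
    have l2: "lucas 3 2 = 3" by (rule lucas_2) simp
    have l3: "lucas 3 3 = 6" using lucas_rec[of 2 3] l2 by simp
    have l4: "lucas 3 4 = 10" using lucas_rec[of 3 3] l3 by simp
    have l5: "lucas 3 5 = 19" using lucas_rec[of 4 3] l4 by simp
    have l6: "lucas 3 6 = 35" using lucas_rec[of 5 3] l5 l2 by simp
    have l7: "lucas 3 7 = 64" using lucas_rec[of 6 3] l6 l3 by simp
    show ?thesis unfolding 2 d using l6 l7 by (intro lucas_neq_between[of 3 6]) auto
  next
    case 3
    have d: "d = 563" using assms(3) by (simp add: 3 disc_num_def eval_nat_numeral)
    have l2: "lucas 4 2 = 3" by (rule lucas_2) simp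
    have l3: "lucas 4 3 = 6" using lucas_rec[of 2 4] l2 by simp
    have l4: "lucas 4 4 = 12" using lucas_rec[of 3 4] l3 by simp
    have l5: "lucas 4 5 = 22" using lucas_rec[of 4 4] l4 by simp
    have l6: "lucas 4 6 = 43" using lucas_rec[of 5 4] l5 by simp
    have l7: "lucas 4 7 = 83" using lucas_rec[of 6 4] l6 l2 by simp
    have l8: "lucas 4 8 = 160" using lucas_rec[of 7 4] l7 l3 by simp
    have l9: "lucas 4 9 = 308" using lucas_rec[of 8 4] l8 l4 by simp
    have l10: "lucas 4 10 = 594" using lucas_rec[of 9 4] l9 l5 by simp
    show ?thesis unfolding 3 d using l9 l10 by (intro lucas_neq_between[of 4 9]) auto
  next
    case 4
    have k: "k - 5 < length [5..<64]" "[5..<64] ! (k - 5) = k"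
      using 4 assms(2) by (simp_all only: length_upt nth_upt)
    obtain e where "small_separated k e"
      using list_all2_nthD[OF small_separated_5_63 k(1)] unfolding k(2) by blast
    then show ?thesis using assms by (intro small_separated_imp) auto
  qed
qed


section \<open>Large parameters\<close>

text \<open>The eighth power turns the error \<open>k ^ 2 / 2 ^ k\<close> into
  \<open>k ^ (- 6)\<close>, below \<open>10 ^ (- 6)\<close> from 64 on, and gives
  \<open>log2 k <= k / 8\<close>.\<close>

lemma power8_le_power2:
  assumes "k \<ge> 64"
  shows "k ^ 8 \<le> (2::nat) ^ k"
  using assms
proof (induction k rule: dec_induct)
  case (step k)
  have "real (k + 1) ^ 8 \<le> (65 / 64 * real k) ^ 8" using step(1) by (intro power_mono) auto
  also have "\<dots> = (65 / 64) ^ 8 * real k ^ 8" by (rule power_mult_distrib)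
  also have "\<dots> \<le> 2 * real k ^ 8" by (intro mult_right_mono) (auto simp: power_divide)
  finally have "real ((k + 1) ^ 8) \<le> real (2 * k ^ 8)" by simp
  then have "(k + 1) ^ 8 \<le> 2 * k ^ 8" by (simp only: of_nat_le_iff)
  then show ?case using step(3) by simp
qed simp

lemma ln_one_minus_ge:
  fixes x :: real
  assumes "0 \<le> x" "x \<le> 1 / 2"
  shows "ln (1 - x) \<ge> - 2 * x"
proof -
  have "- x - 2 * x\<^sup>2 \<le> ln (1 - x)" using assms by (intro ln_one_minus_pos_lower_bound) auto
  moreover have "2 * x\<^sup>2 \<le> x" using assms mult_left_mono[of x "1 / 2" x] by (simp add: power2_eq_square)
  ultimately show ?thesis by linarith
qed

lemma disc_num_real_bounds:
  assumes "k \<ge> 1"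
  shows "real_of_int (disc_num k) \<le> 2 ^ (k + 1) * real k ^ k"
    and "2 ^ (k + 1) * real k ^ k * (1 - 3 * real (k + 1) / 2 ^ (k + 1)) \<le> real_of_int (disc_num k)"
proof -
  have X: "real_of_int (disc_num k) = 2 ^ (k + 1) * real k ^ k - real ((k + 1) ^ (k + 1))"
    by (simp add: disc_num_def algebra_simps)
  have "0 \<le> real ((k + 1) ^ (k + 1))" by (rule of_nat_0_le_iff)
  then show "real_of_int (disc_num k) \<le> 2 ^ (k + 1) * real k ^ k" unfolding X by linarith
  have "real ((k + 1) ^ (k + 1)) \<le> real (3 * (k + 1) * k ^ k)"
    using Suc_power_Suc_le[OF assms] by (simp only: of_nat_le_iff)
  also have "real (3 * (k + 1) * k ^ k) = 3 * real (k + 1) * real k ^ k" by simp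
  finally have "2 ^ (k + 1) * real k ^ k - 3 * real (k + 1) * real k ^ k \<le> real_of_int (disc_num k)"
    unfolding X by linarith
  then show "2 ^ (k + 1) * real k ^ k * (1 - 3 * real (k + 1) / 2 ^ (k + 1)) \<le> real_of_int (disc_num k)"
    by (simp add: right_diff_distrib mult_ac)
qed

section \<open>Size of the index of a hypothetical solution\<close>

context
  fixes k n :: nat and d :: int
  assumes k: "k \<ge> 64" and disc: "d * (int k - 1)\<^sup>2 = disc_num k" and eq: "lucas k n = d"
begin

lemma lucas_times_square: "real_of_int (disc_num k) = of_int (lucas k n) * (real k - 1)\<^sup>2"
  using arg_cong[OF disc[folded eq], of real_of_int] by simp

lemma k_le_power2: "16 * (k + 1) \<le> 2 ^ k" "k\<^sup>2 + k + 2 < 2 ^ k" "8 * ln (real k) \<le> real k * ln 2"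
proof -
  have 8: "k ^ 8 \<le> 2 ^ k" using power8_le_power2[OF k] .
  have arith: "16 * (k + 1) \<le> M" "S + k + 2 < M" if "64 * k \<le> S" "2 * S \<le> E" "E \<le> M" for S E M :: nat
  proof -
    have "16 * k + 16 \<le> M" using that k by linarith
    then show "16 * (k + 1) \<le> M" by simp
    show "S + k + 2 < M" using that k by linarith
  qed
  have "64 * k \<le> k * k" using k by (intro mult_right_mono) auto
  moreover have "2 * k\<^sup>2 \<le> k ^ 8"
  proof -
    have "k ^ 3 \<le> k ^ 8" using k by (intro power_increasing) auto
    moreover have "2 * k\<^sup>2 \<le> k * k\<^sup>2" using k by (intro mult_right_mono) auto
    moreover have "k * k\<^sup>2 = k ^ 3" by (simp add: power2_eq_square power3_eq_cube)
    ultimately show ?thesis by linarith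
  qed
  ultimately show "16 * (k + 1) \<le> 2 ^ k" "k\<^sup>2 + k + 2 < 2 ^ k"
    using arith[of "k\<^sup>2" "k ^ 8" "2 ^ k"] 8 by (simp_all only: power2_eq_square)
  have "real (k ^ 8) \<le> real (2 ^ k)" using 8 by (simp only: of_nat_le_iff)
  then have "ln (real k ^ 8) \<le> ln (2 ^ k)" using k by (subst ln_le_cancel_iff) auto
  then show "8 * ln (real k) \<le> real k * ln 2" using k by (simp add: ln_realpow)
qed

lemma disc_lower_half: "2 ^ k * real k ^ k \<le> real_of_int (disc_num k)"
proof -
  have "real (16 * (k + 1)) \<le> real (2 ^ k)" using k_le_power2(1) by (simp only: of_nat_le_iff)
  then have "3 * real (k + 1) / 2 ^ (k + 1) \<le> 1 / 2" by (simp add: field_simps)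
  then have "2 ^ (k + 1) * real k ^ k * (1 / 2) \<le> 2 ^ (k + 1) * real k ^ k * (1 - 3 * real (k + 1) / 2 ^ (k + 1))"
    by (intro mult_left_mono) auto
  also have "\<dots> \<le> real_of_int (disc_num k)" using k by (intro disc_num_real_bounds) simp
  finally show ?thesis by simp
qed

lemma n_ge_2: "n \<ge> 2"
proof (rule ccontr)
  assume "\<not> n \<ge> 2"
  then have "n = 0 \<or> n = Suc 0" by auto
  then have "lucas k n \<le> 2" by auto
  then have "real_of_int (disc_num k) \<le> 2 * (real k - 1)\<^sup>2"
    unfolding lucas_times_square by (intro mult_right_mono) auto
  moreover have "2 * (real k - 1)\<^sup>2 < 2 ^ k * real k ^ k"
  proof -
    have "2 * (real k - 1)\<^sup>2 \<le> 2 * real k ^ 2" using k by (intro mult_left_mono power_mono) auto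
    also have "\<dots> \<le> 2 * real k ^ k" using k by (intro mult_left_mono power_increasing) auto
    also have "\<dots> < 2 ^ k * real k ^ k"
    proof (rule mult_strict_right_mono)
      have "(2::real) ^ 1 < 2 ^ k" using k by (intro power_strict_increasing) auto
      then show "(2::real) < 2 ^ k" by simp
    qed (use k in simp)
    finally show ?thesis .
  qed
  ultimately show False using disc_lower_half by linarith
qed

definition main_term :: real where
  "main_term = 3 / 4 * 2 ^ n * (real k - 1)\<^sup>2"

lemma disc_le_main_term: "real_of_int (disc_num k) \<le> main_term"
proof -
  have "4 * lucas k n \<le> 3 * 2 ^ n" using n_ge_2 k by (intro lucas_upper) auto
  then have "real_of_int (4 * lucas k n) \<le> real_of_int (3 * 2 ^ n)" by (simp only: of_int_le_iff)
  then have "of_int (lucas k n) \<le> (3 / 4 * 2 ^ n :: real)" by simp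
  then show ?thesis unfolding lucas_times_square main_term_def by (intro mult_right_mono) auto
qed

lemma main_term_le_disc: "main_term * (1 - real n / 2 ^ (k + 1)) \<le> real_of_int (disc_num k)"
proof -
  have "3 * 2 ^ n * (2 ^ (k + 1) - int n) \<le> 4 * 2 ^ (k + 1) * lucas k n"
    using n_ge_2 k by (intro lucas_lower) auto
  then have "real_of_int (3 * 2 ^ n * (2 ^ (k + 1) - int n)) \<le> real_of_int (4 * 2 ^ (k + 1) * lucas k n)"
    by (simp only: of_int_le_iff)
  then have "3 / 4 * 2 ^ n * (1 - real n / 2 ^ (k + 1)) \<le> of_int (lucas k n)"
    by (simp add: field_simps)
  then have "3 / 4 * 2 ^ n * (1 - real n / 2 ^ (k + 1)) * (real k - 1)\<^sup>2 \<le> of_int (lucas k n) * (real k - 1)\<^sup>2"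
    by (intro mult_right_mono) auto
  then show ?thesis unfolding lucas_times_square main_term_def by (simp only: mult_ac)
qed

text \<open>The lower bound for Lucas numbers is void beyond \<open>2 ^ (k + 1)\<close>, so
  monotonicity is used to replace a large \<open>n\<close> by \<open>2 ^ k\<close>. There the bound
  has order \<open>2 ^ (2 ^ k)\<close>, whereas eight times \<open>disc_num k\<close> is at most
  \<open>2 ^ (k\<^sup>2 + k + 2)\<close>.\<close>

lemma n_le_power2: "n \<le> 2 ^ k"
proof (rule ccontr)
  assume "\<not> n \<le> 2 ^ k"
  then have "lucas k (2 ^ k) \<le> lucas k n" using k by (intro lucas_mono) auto
  moreover have "3 * 2 ^ (2 ^ k) * (2 ^ (k + 1) - int (2 ^ k)) \<le> 4 * 2 ^ (k + 1) * lucas k (2 ^ k)"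
  proof (rule lucas_lower)
    have "(2::nat) ^ 1 \<le> 2 ^ k" using k by (intro power_increasing) auto
    then show "(2::nat) \<le> 2 ^ k" by simp
  qed (use k in simp)
  then have "2 ^ k * (3 * 2 ^ (2 ^ k)) \<le> 2 ^ k * (8 * lucas k (2 ^ k))" by (simp add: algebra_simps)
  then have "3 * 2 ^ (2 ^ k) \<le> 8 * lucas k (2 ^ k)" by simp
  ultimately have "3 * 2 ^ (2 ^ k) \<le> 8 * lucas k n" by linarith
  then have "real_of_int (3 * 2 ^ (2 ^ k)) \<le> real_of_int (8 * lucas k n)" by (simp only: of_int_le_iff)
  then have 1: "3 * 2 ^ (2 ^ k) \<le> 8 * real_of_int (lucas k n)" by simp
  have 2: "1 \<le> (real k - 1)\<^sup>2" using k by (simp add: one_le_power)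
  have "3 * 2 ^ (2 ^ k) * 1 \<le> 8 * real_of_int (lucas k n) * (real k - 1)\<^sup>2"
    using mult_mono[OF 1 2] by (simp add: lucas_nonneg)
  also have "\<dots> = 8 * real_of_int (disc_num k)" unfolding lucas_times_square by simp
  also have "\<dots> \<le> 8 * (2 ^ (k + 1) * real k ^ k)"
    using k by (intro mult_left_mono disc_num_real_bounds) auto
  also have "\<dots> \<le> 8 * (2 ^ (k + 1) * 2 ^ (k\<^sup>2 - 2))"
  proof -
    have "k ^ 8 \<le> 2 ^ k" using power8_le_power2[OF k] .
    moreover have "4 * k \<le> k ^ 8"
    proof -
      have "k ^ 2 \<le> k ^ 8" using k by (intro power_increasing) auto
      moreover have "4 * k \<le> k ^ 2" using k by (simp add: power2_eq_square)
      ultimately show ?thesis by linarith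
    qed
    ultimately have "4 * k \<le> 2 ^ k" by linarith
    then have "real (4 * k) \<le> real (2 ^ k)" by (simp only: of_nat_le_iff)
    then have "real k \<le> 2 ^ k / 4" by simp
    then have "real k ^ k \<le> (2 ^ k / 4) ^ k" by (intro power_mono) auto
    also have "\<dots> = 2 ^ (k\<^sup>2) / 4 ^ k" by (simp add: power_divide power2_eq_square flip: power_mult)
    also have "\<dots> \<le> 2 ^ (k\<^sup>2) / 4 ^ 1"
      using k by (intro divide_left_mono power_increasing) auto
    also have "\<dots> = 2 ^ (k\<^sup>2 - 2)"
    proof -
      have "2 * 1 \<le> k * k" using k by (intro mult_le_mono) auto
      then have "2 \<le> k\<^sup>2" by (simp add: power2_eq_square)
      then have "(2::real) ^ (k\<^sup>2) = 2 ^ (k\<^sup>2 - 2) * 2 ^ 2" by (metis le_add_diff_inverse2 power_add)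
      then show ?thesis by simp
    qed
    finally show ?thesis by (intro mult_left_mono) auto
  qed
  also have "\<dots> = 2 ^ (3 + (k + 1) + (k\<^sup>2 - 2))" by (simp only: power_add) simp
  also have "3 + (k + 1) + (k\<^sup>2 - 2) = k\<^sup>2 + k + 2"
  proof -
    have "2 * 1 \<le> k * k" using k by (intro mult_le_mono) auto
    then show ?thesis by (simp add: power2_eq_square)
  qed
  finally have "(2::real) ^ (2 ^ k) < 2 ^ (k\<^sup>2 + k + 2)"
    using zero_less_power[of "2::real" "2 ^ k"] by linarith
  then have "2 ^ k < k\<^sup>2 + k + 2" by (simp only: power_strict_increasing_iff)
  then show False using k_le_power2(2) by simp
qed

text \<open>With the relative error now at most 1 / 2, logarithms give
  \<open>n <= k + 1 + k * log2 k\<close>. The quadratic bound serves twice: for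
  \<open>n <= k ^ 2\<close> in the error term and for \<open>8 * (p + 1) <= k\<close> in the 2-adic
  estimate.\<close>

lemma n_upper_nat: "8 * n \<le> k\<^sup>2 + 8 * k + 8"
proof -
  have "real n \<le> real (2 ^ k)" using n_le_power2 by (simp only: of_nat_le_iff)
  then have "1 / 2 \<le> 1 - real n / 2 ^ (k + 1)" by (simp add: field_simps)
  then have "main_term * (1 / 2) \<le> main_term * (1 - real n / 2 ^ (k + 1))"
    by (intro mult_left_mono) (auto simp: main_term_def)
  also have "\<dots> \<le> 2 ^ (k + 1) * real k ^ k"
    using main_term_le_disc disc_num_real_bounds(1)[of k] k by linarith
  finally have 1: "3 / 8 * (real k - 1)\<^sup>2 * 2 ^ n \<le> 2 ^ (k + 1) * real k ^ k"
    by (simp add: main_term_def mult_ac)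
  have "1 * 2 ^ n \<le> 3 / 8 * (real k - 1)\<^sup>2 * 2 ^ n"
  proof (intro mult_right_mono)
    have "(63::real)\<^sup>2 \<le> (real k - 1)\<^sup>2" using k by (intro power_mono) auto
    then show "1 \<le> 3 / 8 * (real k - 1)\<^sup>2" by simp
  qed auto
  with 1 have "(2::real) ^ n \<le> 2 ^ (k + 1) * real k ^ k" by linarith
  then have "ln ((2::real) ^ n) \<le> ln (2 ^ (k + 1) * real k ^ k)" using k by (subst ln_le_cancel_iff) auto
  also have "\<dots> = ln (2 ^ (k + 1)) + ln (real k ^ k)" using k by (intro ln_mult_pos) auto
  finally have "real n * ln 2 \<le> real (k + 1) * ln 2 + real k * ln (real k)"
    by (simp only: ln_realpow)
  then have "8 * (real n * ln 2) \<le> 8 * (real (k + 1) * ln 2) + real k * (8 * ln (real k))" by simp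
  also have "real k * (8 * ln (real k)) \<le> real k * (real k * ln 2)"
    using k_le_power2(3) by (intro mult_left_mono) auto
  finally have "(8 * real n) * ln 2 \<le> (8 * real (k + 1) + real k * real k) * ln 2"
    by (simp add: algebra_simps)
  then have "8 * real n \<le> 8 * real (k + 1) + real k * real k" by simp
  then have "real (8 * n) \<le> real (k\<^sup>2 + 8 * k + 8)" by (simp add: power2_eq_square)
  then show ?thesis by (simp only: of_nat_le_iff)
qed

text \<open>The logarithm of \<open>2 ^ (k + 1) * k ^ k / main_term\<close>, the ratio of the
  dominant terms of the two sides.\<close>

definition log_error :: real where
  "log_error = real k * ln (real k) + (real k + 3 - real n) * ln 2 - ln 3 - 2 * ln (real k - 1)"

lemma abs_log_error: "\<bar>log_error\<bar> \<le> (real k)\<^sup>2 / 2 ^ k"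
proof -
  define P where "P = 2 ^ (k + 1) * real k ^ k"
  have P: "P > 0" and T: "main_term > 0" using k by (auto simp: P_def main_term_def)
  have "ln P = ln (2 ^ (k + 1)) + ln (real k ^ k)"
    unfolding P_def using k by (intro ln_mult_pos) auto
  also have "ln ((2::real) ^ (k + 1)) = real (k + 1) * ln 2" by (rule ln_realpow)
  also have "ln (real k ^ k) = real k * ln (real k)" by (rule ln_realpow)
  finally have lnP: "ln P = real (k + 1) * ln 2 + real k * ln (real k)" .
  have "ln main_term = ln (3 / 4 * 2 ^ n) + ln ((real k - 1)\<^sup>2)"
    unfolding main_term_def using k by (intro ln_mult_pos) auto
  also have "ln (3 / 4 * (2::real) ^ n) = ln (3 / 4) + ln (2 ^ n)" by (intro ln_mult_pos) auto
  also have "ln ((2::real) ^ n) = real n * ln 2" by (rule ln_realpow)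
  also have "ln ((real k - 1)\<^sup>2) = 2 * ln (real k - 1)"
    using k ln_realpow[of "real k - 1" 2] by simp
  also have "ln (3 / 4 :: real) = ln 3 - 2 * ln 2"
    using ln_realpow[of 2 2] by (simp add: ln_div)
  finally have err: "log_error = ln P - ln main_term"
    unfolding lnP log_error_def by (simp add: algebra_simps)
  have n1: "real n / 2 ^ (k + 1) \<le> 1 / 2"
  proof -
    have "real n \<le> real (2 ^ k)" using n_le_power2 by (simp only: of_nat_le_iff)
    then show ?thesis by (simp add: field_simps)
  qed
  have y1: "3 * real (k + 1) / 2 ^ (k + 1) \<le> 1 / 2"
  proof -
    have "real (16 * (k + 1)) \<le> real (2 ^ k)" using k_le_power2(1) by (simp only: of_nat_le_iff)
    then show ?thesis by (simp add: field_simps)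
  qed
  have n2: "0 < 1 - real n / 2 ^ (k + 1)" and y2: "0 < 1 - 3 * real (k + 1) / 2 ^ (k + 1)"
    using n1 y1 by linarith+
  have "main_term * (1 - real n / 2 ^ (k + 1)) \<le> P"
    using main_term_le_disc disc_num_real_bounds(1)[of k] k unfolding P_def by linarith
  then have "ln (main_term * (1 - real n / 2 ^ (k + 1))) \<le> ln P"
    using mult_pos_pos[OF T n2] P by (subst ln_le_cancel_iff)
  moreover have "ln (main_term * (1 - real n / 2 ^ (k + 1))) = ln main_term + ln (1 - real n / 2 ^ (k + 1))"
    using T n2 by (rule ln_mult_pos)
  moreover have "ln (1 - real n / 2 ^ (k + 1)) \<ge> - 2 * (real n / 2 ^ (k + 1))"
    using n1 by (intro ln_one_minus_ge) auto
  ultimately have lower: "log_error \<ge> - 2 * (real n / 2 ^ (k + 1))" unfolding err by linarith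
  have "P * (1 - 3 * real (k + 1) / 2 ^ (k + 1)) \<le> main_term"
    using disc_le_main_term disc_num_real_bounds(2)[of k] k unfolding P_def by linarith
  then have "ln (P * (1 - 3 * real (k + 1) / 2 ^ (k + 1))) \<le> ln main_term"
    using mult_pos_pos[OF P y2] T by (subst ln_le_cancel_iff)
  moreover have "ln (P * (1 - 3 * real (k + 1) / 2 ^ (k + 1))) = ln P + ln (1 - 3 * real (k + 1) / 2 ^ (k + 1))"
    using P y2 by (rule ln_mult_pos)
  moreover have "ln (1 - 3 * real (k + 1) / 2 ^ (k + 1)) \<ge> - 2 * (3 * real (k + 1) / 2 ^ (k + 1))"
    using y1 by (intro ln_one_minus_ge) auto
  ultimately have upper: "log_error \<le> 2 * (3 * real (k + 1) / 2 ^ (k + 1))" unfolding err by linarith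
  have "64 * k \<le> k\<^sup>2" using k by (simp add: power2_eq_square)
  then have "n \<le> k\<^sup>2" and "3 * k + 3 \<le> k\<^sup>2" using n_upper_nat k by linarith+
  then have "real n \<le> real (k\<^sup>2)" "real (3 * k + 3) \<le> real (k\<^sup>2)" by (simp_all only: of_nat_le_iff)
  then have "real n / 2 ^ k \<le> (real k)\<^sup>2 / 2 ^ k" "3 * real (k + 1) / 2 ^ k \<le> (real k)\<^sup>2 / 2 ^ k"
    by (auto intro!: divide_right_mono)
  moreover have "2 * (real n / 2 ^ (k + 1)) = real n / 2 ^ k"
    "2 * (3 * real (k + 1) / 2 ^ (k + 1)) = 3 * real (k + 1) / 2 ^ k" by (simp_all add: field_simps)
  ultimately show ?thesis using lower upper by linarith
qed

lemma abs_log_error_tiny: "\<bar>log_error\<bar> \<le> 1 / 10 ^ 6"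
proof -
  have "real (k ^ 8) \<le> real (2 ^ k)" using power8_le_power2[OF k] by (simp only: of_nat_le_iff)
  then have "(real k)\<^sup>2 / 2 ^ k \<le> (real k)\<^sup>2 / real k ^ 8"
    using k by (intro divide_left_mono) auto
  also have "\<dots> = 1 / real k ^ 6" using k by (simp add: field_simps flip: power_add)
  also have "\<dots> \<le> 1 / 64 ^ 6" using k by (intro divide_left_mono power_mono) auto
  also have "\<dots> \<le> 1 / 10 ^ 6" by simp
  finally show ?thesis using abs_log_error by linarith
qed

text \<open>It makes the quotient of \<open>n\<close> by \<open>k + 1\<close> at least 2, as the
  closed form of \<open>row_coeff (p + 2)\<close> requires.\<close>

lemma n_lower: "2 * (k + 1) \<le> n"
proof -
  have "6 * ln 2 \<le> ln (real k)"
  proof -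
    have "ln (2 ^ 6) \<le> ln (real k)" using k by (subst ln_le_cancel_iff) auto
    then show ?thesis using ln_realpow[of 2 6] by simp
  qed
  then have "(real k - 2) * (6 * ln 2) \<le> (real k - 2) * ln (real k)" using k by (intro mult_left_mono) auto
  moreover have "ln (real k - 1) \<le> ln (real k)" using k by (subst ln_le_cancel_iff) auto
  moreover have "(real n - real k - 3) * ln 2 = real k * ln (real k) - ln 3 - 2 * ln (real k - 1) - log_error"
    by (simp add: log_error_def algebra_simps)
  ultimately have "(real n - real k - 3) * ln 2 \<ge> (real k - 2) * (6 * ln 2) - 4 * ln 2"
    using abs_log_error_tiny ln_2_bounds ln_3_bounds by (simp add: algebra_simps)
  then have "(real n - real k - 3) * ln 2 \<ge> (6 * (real k - 2) - 4) * ln 2" by (simp add: algebra_simps)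
  then have "real n - real k - 3 \<ge> 6 * (real k - 2) - 4" by simp
  then have "real n \<ge> real (2 * (k + 1))" using k by simp
  then show ?thesis by (simp only: of_nat_le_iff)
qed

end


section \<open>Reduction to \<open>k\<close> close to a power of 2\<close>

lemma ln_2_bounds_coarse: "6931 / 10000 < ln (2::real)" "ln (2::real) < 6932 / 10000"
  using ln_2_bounds by simp_all

lemma ln_3_bounds_coarse: "10986 / 10000 < ln (3::real)" "ln (3::real) < 10987 / 10000"
  using ln_3_bounds by simp_all

lemma row_bound_cubic:
  assumes "k \<ge> 64" "m \<le> k" "8 * (p + 1) \<le> k"
  shows "(m + p + 1) * row_quad p m \<le> 6 * k ^ 3"
proof -
  have p: "8 * p + 8 \<le> k" using assms(3) by simp
  have "8 * m + 8 * p + 8 \<le> 9 * k" using assms(2) p by linarith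
  then have 1: "8 * (m + p + 1) \<le> 9 * k" by simp
  have "24 * m + 56 * p + 112 \<le> 32 * k" using assms(1,2) p by linarith
  then have 2: "8 * (3 * m + 7 * p + 14) \<le> 32 * k" by simp
  have 3: "8 * (p + 2) \<le> 2 * k" using assms(1) p by simp
  have "64 * row_quad p m = (8 * (m + p + 1)) * (8 * (3 * m + 7 * p + 14)) + (8 * (p + 2)) * (8 * (p + 1))"
    by (simp add: row_quad_def algebra_simps)
  also have "\<dots> \<le> (9 * k) * (32 * k) + (2 * k) * k"
    by (rule add_mono[OF mult_le_mono[OF 1 2] mult_le_mono[OF 3 assms(3)]])
  finally have "64 * row_quad p m \<le> 290 * (k * k)" by simp
  with 1 have "(8 * (m + p + 1)) * (64 * row_quad p m) \<le> (9 * k) * (290 * (k * k))"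
    by (rule mult_le_mono)
  then have "512 * ((m + p + 1) * row_quad p m) \<le> 2610 * (k * k * k)"
    by (simp only: mult_ac)
  then show ?thesis by (simp add: power3_eq_cube)
qed

text \<open>For even \<open>k\<close> the remainder is 1 or 2 and serves as \<open>j\<close>, with
  \<open>s + 1\<close> the quotient. For odd \<open>k\<close> the remainder is close to
  \<open>k + 1\<close>, so \<open>n\<close> is counted back from the next multiple: \<open>s\<close>
  is the quotient and \<open>j\<close> is negative.\<close>

lemma lucas_eq_disc_index:
  assumes k: "k \<ge> 64" and disc: "d * (int k - 1)\<^sup>2 = disc_num k" and eq: "lucas k n = d"
  obtains s :: nat and j :: int
  where "int n = (int s + 1) * (int k + 1) + j" "j \<le> 2" "2 ^ nat (- j) \<le> 6 * k ^ 3"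
proof -
  define q where "q = n div (k + 1)"
  define m where "m = n mod (k + 1)"
  have n: "n = q * (k + 1) + m" by (simp only: q_def m_def div_mult_mod_eq)
  have m: "m \<le> k" using mod_less_divisor[of "k + 1" n] by (simp add: m_def)
  have q: "q \<ge> 2" unfolding q_def using n_lower[OF k disc eq] by (simp only: less_eq_div_iff_mult_less_eq)
  show thesis
  proof (cases "even k")
    case True
    then have "odd (lucas k n)" using odd_abs_disc[OF _ disc] eq by simp
    then have "m = 1 \<or> m = 2" unfolding m_def using odd_lucas_mod[of k n] k by simp
    moreover have "int n = (int (q - 1) + 1) * (int k + 1) + int m"
      using q unfolding n by (simp add: of_nat_diff algebra_simps)
    ultimately show thesis using k by (intro that[of "q - 1" "int m"]) auto
  next
    case False
    define p where "p = q - 2"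
    have "q = p + 2" using q by (simp add: p_def)
    with n have n': "n = (p + 2) * (k + 1) + m" by (simp only:)
    have "8 * ((p + 1) * (k + 1)) \<le> k * k"
      using n_upper_nat[OF k disc eq] unfolding n' by (simp add: power2_eq_square algebra_simps)
    then have "8 * (p + 1) * (k + 1) \<le> k * (k + 1)" by (simp add: algebra_simps)
    then have p: "8 * (p + 1) \<le> k" by (simp only: mult_le_cancel2)
    have "2 ^ (k - 1) dvd lucas k n" unfolding eq using False k disc by (intro power2_dvd_abs_disc) auto
    then have "2 ^ (k + 1 - m) \<le> (m + p + 1) * row_quad p m"
      unfolding n' using k m by (intro power2_dvd_lucas_bound) auto
    also have "\<dots> \<le> 6 * k ^ 3" using k m p by (rule row_bound_cubic)
    finally have "2 ^ (k + 1 - m) \<le> 6 * k ^ 3" .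
    moreover have "- (int m - int (k + 1)) = int (k + 1 - m)" using m by (simp add: of_nat_diff)
    ultimately have "2 ^ nat (- (int m - int (k + 1))) \<le> 6 * k ^ 3" by (simp only: nat_int)
    moreover have "int n = (int q + 1) * (int k + 1) + (int m - int (k + 1))"
      unfolding n by (simp add: algebra_simps)
    ultimately show thesis using m by (intro that[of q "int m - int (k + 1)"]) auto
  qed
qed

lemma lucas_eq_disc_dyadic:
  assumes k: "k \<ge> 64" and disc: "d * (int k - 1)\<^sup>2 = disc_num k" and eq: "lucas k n = d"
  obtains s :: nat and r t :: int
  where "int k = 2 ^ s + r" "6 \<le> s" "-2 \<le> r" "10 * r \<le> 21 * int s + 30"
    "log_error k n = real k * ln (real k / 2 ^ s) - 2 * ln ((real k - 1) / 2 ^ s) - ln 3 - of_int t * ln 2"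
proof -
  obtain s :: nat and j :: int
    where n: "int n = (int s + 1) * (int k + 1) + j" and j: "j \<le> 2" "2 ^ nat (- j) \<le> 6 * k ^ 3"
    using lucas_eq_disc_index[OF k disc eq] by blast
  note err = log_error_def[OF k disc eq]
  define e where "e = log_error k n"
  have e: "\<bar>e\<bar> \<le> 1 / 1000000" unfolding e_def using abs_log_error_tiny[OF k disc eq] by simp
  define u where "u = ln (real k) - real s * ln 2"
  have lnk8: "8 * ln (real k) \<le> real k * ln 2" by (rule k_le_power2(3)[OF k disc eq])
  have lnk6: "6 * ln 2 \<le> ln (real k)"
  proof -
    have "ln (2 ^ 6) \<le> ln (real k)" using k by (subst ln_le_cancel_iff) auto
    then show ?thesis using ln_realpow[of 2 6] by simp
  qed
  have "real_of_int (int n) = real_of_int ((int s + 1) * (int k + 1) + j)" using n by (simp only:)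
  then have n_real: "real n = (real s + 1) * (real k + 1) + of_int j" by simp
  have e_eq: "e = real k * u - (real s + of_int j - 2) * ln 2 - ln 3 - 2 * ln (real k - 1)"
    unfolding e_def err u_def n_real by (simp add: algebra_simps)
  have ku: "(real k + 1) * u = e + ln 3 + (of_int j - 2) * ln 2 + 2 * ln (real k - 1) + ln (real k)"
    unfolding e_eq by (simp add: u_def algebra_simps)
  have j_lower: "- of_int j * ln 2 \<le> ln 6 + 3 * ln (real k)"
  proof -
    have "real (2 ^ nat (- j)) \<le> real (6 * k ^ 3)" using j(2) by (simp only: of_nat_le_iff)
    then have "ln (2 ^ nat (- j)) \<le> ln (6 * real k ^ 3)" using k by (subst ln_le_cancel_iff) auto
    also have "\<dots> = ln 6 + ln (real k ^ 3)" using k by (intro ln_mult_pos) auto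
    also have "ln (real k ^ 3) = 3 * ln (real k)" using k ln_realpow[of "real k" 3] by simp
    also have "ln ((2::real) ^ nat (- j)) = real (nat (- j)) * ln 2" by (rule ln_realpow)
    finally have "real (nat (- j)) * ln 2 \<le> ln 6 + 3 * ln (real k)" .
    moreover have "- of_int j * ln 2 \<le> real (nat (- j)) * ln (2::real)" by (intro mult_right_mono) auto
    ultimately show ?thesis by linarith
  qed
  have ln6: "ln (6::real) = ln 2 + ln 3" using ln_mult_pos[of 2 3] by simp
  have lnk1: "ln (real k - 1) \<le> ln (real k)" "ln (real k) - 2 / 64 \<le> ln (real k - 1)"
  proof -
    show "ln (real k - 1) \<le> ln (real k)" using k by (subst ln_le_cancel_iff) auto
    have "ln (real k - 1) = ln (real k * (1 - 1 / real k))" using k by (simp add: field_simps)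
    also have "\<dots> = ln (real k) + ln (1 - 1 / real k)" using k by (intro ln_mult_pos) auto
    also have "ln (1 - 1 / real k) \<ge> - 2 * (1 / real k)" using k by (intro ln_one_minus_ge) auto
    moreover have "1 / real k \<le> 1 / 64" using k by (intro divide_left_mono) auto
    ultimately show "ln (real k) - 2 / 64 \<le> ln (real k - 1)" by linarith
  qed
  note l2 = ln_2_bounds_coarse and l3 = ln_3_bounds_coarse
  have j_upper: "(of_int j - 2) * ln 2 \<le> (0::real)" using j(1) by (intro mult_nonpos_nonneg) auto
  have ku_upper: "(real k + 1) * u \<le> 1 / 1000000 + ln 3 + 3 * ln (real k)"
    using ku j_upper lnk1(1) e by linarith
  \<comment> \<open>The cubic bound on \<open>2 ^ (- j)\<close> is just strong enough: its
    \<open>3 * ln k\<close> cancels against \<open>2 * ln (k - 1) + ln k\<close>, leaving about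
    \<open>- 3 * ln 2\<close>. Hence \<open>r\<close> cannot fall below -2.\<close>
  have ku_lower: "(real k + 1) * u \<ge> - 215 / 100"
  proof -
    have "(of_int j - 2) * ln (2::real) = - (- of_int j * ln 2) - 2 * ln 2" by (simp add: algebra_simps)
    then show ?thesis using ku j_lower lnk1(2) e l2 unfolding ln6 by (simp add: abs_le_iff)
  qed
  have kpos: "real k \<ge> 64" using k by simp
  have u_upper: "u \<le> 28 / 100"
  proof -
    have "real k * ln 2 \<le> real k * (6932 / 10000)" using l2 by (intro mult_left_mono) auto
    then have "3 * ln (real k) \<le> 26 / 100 * real k" using lnk8 kpos by linarith
    then have "(real k + 1) * u \<le> (real k + 1) * (28 / 100)" using ku_upper l3 kpos by (simp add: algebra_simps)
    then show ?thesis by (rule mult_left_le_imp_le) (use kpos in simp)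
  qed
  have exp_u: "exp u = real k / 2 ^ s"
    using k exp_nat_mult_ln[of 2 s] by (simp add: u_def exp_diff)
  then have pow: "2 ^ s = real k * exp (- u)" by (simp add: exp_minus field_simps)
  define r where "r = int k - 2 ^ s"
  have r_real: "real_of_int r = real k * (1 - exp (- u))"
    by (simp add: r_def pow algebra_simps)
  have s6: "s \<ge> 6"
  proof -
    have "real s * ln 2 \<ge> 6 * ln 2 - 28 / 100" using u_upper lnk6 by (simp add: u_def)
    then have "5 * ln 2 < real s * ln 2" using l2 by linarith
    then show ?thesis by simp
  qed
  have "r \<ge> -2"
  proof (rule ccontr)
    assume "\<not> r \<ge> -2"
    then have "r \<le> -3" by simp
    then have "real k * (exp (- u) - 1) \<ge> 3" using r_real by (simp add: algebra_simps)
    moreover have "real k * (exp (- u) - 1) < 3"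
    proof (cases "u \<ge> 0")
      case True
      then show ?thesis using kpos by (simp add: mult_le_0_iff order.strict_trans1[of _ 0])
    next
      case False
      define v where "v = - u"
      have v: "v \<ge> 0" "(real k + 1) * v \<le> 215 / 100" using False ku_lower by (auto simp: v_def)
      have "65 * v \<le> (real k + 1) * v" using v(1) kpos by (intro mult_right_mono) auto
      then have v1: "v \<le> 4 / 100" using v(2) by linarith
      then have "exp v \<le> 1 + v + v\<^sup>2" using v(1) by (intro exp_bound) auto
      moreover have "v\<^sup>2 \<le> 4 / 100 * v" unfolding power2_eq_square using v1 v(1) by (rule mult_right_mono)
      ultimately have "exp v - 1 \<le> 104 / 100 * v" by linarith
      then have "real k * (exp v - 1) \<le> real k * (104 / 100 * v)" by (intro mult_left_mono) auto
      also have "\<dots> \<le> 104 / 100 * ((real k + 1) * v)" using v(1) by (simp add: algebra_simps)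
      also have "\<dots> < 3" using v(2) by linarith
      finally show ?thesis by (simp add: v_def)
    qed
    ultimately show False by linarith
  qed
  \<comment> \<open>As \<open>1 - exp (- u) <= u\<close>, the offset \<open>r\<close> is at most
    \<open>k * u\<close>, roughly \<open>3 * s * ln 2\<close> plus a constant; the slope 21 / 10
    lies just above \<open>3 * ln 2\<close>.\<close>
  moreover have "10 * r \<le> 21 * int s + 30"
  proof -
    have "1 - exp (- u) \<le> u" using exp_ge_add_one_self[of "- u"] by linarith
    then have "real_of_int r \<le> real k * u" unfolding r_real by (intro mult_left_mono) auto
    also have "real k * u \<le> 215 / 100 / 65 + (real k + 1) * u"
    proof -
      have "65 * (- u) \<le> 215 / 100"
      proof (cases "u \<ge> 0")
        case False
        then have "65 * (- u) \<le> (real k + 1) * (- u)" using kpos by (intro mult_right_mono) auto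
        then show ?thesis using ku_lower by simp
      qed simp
      then show ?thesis by (simp add: algebra_simps)
    qed
    also have "(real k + 1) * u \<le> 1 / 1000000 + ln 3 + 3 * (real s * ln 2 + 28 / 100)"
      using ku_upper u_upper by (simp add: u_def)
    finally have "real_of_int r \<le> 215 / 100 / 65 + 1 / 1000000 + ln 3 + 3 * (real s * ln 2) + 84 / 100" by simp
    moreover have "real s * ln 2 \<le> real s * (6932 / 10000)" using l2 by (intro mult_left_mono) auto
    ultimately have "10 * real_of_int r \<le> 21 * real s + 30" using l3 by (simp add: field_simps)
    then have "real_of_int (10 * r) \<le> real_of_int (21 * int s + 30)" by simp
    then show ?thesis by (simp only: of_int_le_iff)
  qed
  \<comment> \<open>Replacing \<open>k\<close> and \<open>k - 1\<close> by their quotients by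
    \<open>2 ^ s\<close> changes the coefficient of \<open>ln 2\<close> by
    \<open>k * s - 2 * s\<close>; with the value of \<open>n\<close> it becomes
    \<open>2 - 3 * s - j\<close>.\<close>
  moreover have "e = real k * ln (real k / 2 ^ s) - 2 * ln ((real k - 1) / 2 ^ s) - ln 3
      - of_int (3 * int s + j - 2) * ln 2"
  proof -
    have 1: "ln (real k / 2 ^ s) = u" using k by (simp add: u_def ln_div ln_realpow)
    have 2: "ln ((real k - 1) / 2 ^ s) = ln (real k - 1) - real s * ln 2" using k by (simp add: ln_div ln_realpow)
    show ?thesis unfolding 1 2 e_eq by (simp add: algebra_simps)
  qed
  ultimately show thesis
    using s6 by (intro that[of s r "3 * int s + j - 2"]) (auto simp: r_def e_def)
qed

lemma int_mult_ln_2_gap: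
  fixes u :: int and y :: real
  assumes "of_int u * ln 2 < y" "y < of_int (u + 1) * ln 2"
  shows "y \<noteq> of_int t * ln 2"
proof
  assume "y = of_int t * ln 2"
  then have "of_int u * ln 2 < of_int t * ln (2::real)" "of_int t * ln 2 < of_int (u + 1) * ln (2::real)"
    using assms by simp_all
  then have "real_of_int u < of_int t" "real_of_int t < of_int (u + 1)" by simp_all
  then have "u < t" "t < u + 1" by (simp_all only: of_int_less_iff)
  then show False by linarith
qed

text \<open>For \<open>k = 2 ^ s - w\<close> the term \<open>k * ln (k / 2 ^ s)\<close> is close to
  \<open>- w\<close>, so \<open>t * ln 2\<close> would be close to \<open>- w - ln 3\<close>. For
  \<open>w = 0\<close> and \<open>w = 2\<close> this value is well separated from the multiples of
  \<open>ln 2\<close>.\<close>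

lemma nonpos_offset_impossible:
  assumes k: "k \<ge> 64" and kr: "int k = 2 ^ s + r" and r: "-2 \<le> r" "r \<le> 0"
    and e: "\<bar>real k * ln (real k / 2 ^ s) - 2 * ln ((real k - 1) / 2 ^ s) - ln 3 - of_int t * ln 2\<bar> \<le> 1 / 1000000"
  shows False
proof -
  define w where "w = - real_of_int r"
  have w: "0 \<le> w" "w \<le> 2" using r by (auto simp: w_def)
  have "real_of_int (int k) = real_of_int (2 ^ s + r)" using kr by (simp only:)
  then have pow: "2 ^ s = real k + w" by (simp add: w_def)
  have kpos: "real k \<ge> 64" using k by simp
  define z where "z = w / real k"
  define c where "c = (w + 1) / (real k - 1)"
  have z: "z \<ge> 0" and c: "c \<ge> 0" using w kpos by (auto simp: z_def c_def)
  have "real k / 2 ^ s = inverse (1 + z)" unfolding pow z_def using kpos by (simp add: field_simps)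
  then have ln1: "ln (real k / 2 ^ s) = - ln (1 + z)" using z by (simp add: ln_inverse)
  have "(real k - 1) / 2 ^ s = inverse (1 + c)" unfolding pow c_def using kpos w by (simp add: field_simps)
  then have ln2: "ln ((real k - 1) / 2 ^ s) = - ln (1 + c)" using c by (simp add: ln_inverse)
  have kz: "real k * z = w" using kpos by (simp add: z_def)
  have "ln (1 + z) \<le> z" using z by (rule ln_add_one_self_le_self)
  then have "real k * ln (1 + z) \<le> real k * z" by (intro mult_left_mono) auto
  then have A: "real k * ln (1 + z) \<le> w" unfolding kz .
  have "z - z\<^sup>2 / 2 \<le> ln (1 + z)"
  proof -
    have "z ^ 4 \<le> z ^ 3"
      using z w kpos by (intro power_decreasing) (auto simp: z_def)
    moreover have "z ^ 3 \<ge> 0" using z by simp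
    ultimately show ?thesis using ln_one_plus_Taylor_bounds(1)[OF z] by linarith
  qed
  then have "real k * (z - z\<^sup>2 / 2) \<le> real k * ln (1 + z)" by (intro mult_left_mono) auto
  moreover have "real k * (z - z\<^sup>2 / 2) = w - w * z / 2"
    using kz by (simp add: power2_eq_square algebra_simps)
  ultimately have B: "w - w * z / 2 \<le> real k * ln (1 + z)" by simp
  have C: "ln (1 + c) \<le> c" using c by (rule ln_add_one_self_le_self)
  have c63: "c \<le> (w + 1) / 63" unfolding c_def using kpos w by (intro divide_left_mono) auto
  have z64: "z \<le> w / 64" unfolding z_def using kpos w by (intro divide_left_mono) auto
  have D: "ln (1 + c) \<ge> 0" using c by simp
  define y where "y = of_int t * ln (2::real)"
  have e': "\<bar>- (real k * ln (1 + z)) + 2 * ln (1 + c) - ln 3 - y\<bar> \<le> 1 / 1000000"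
    using e unfolding ln1 ln2 y_def by simp
  note l2 = ln_2_bounds_coarse and l3 = ln_3_bounds_coarse
  have lo: "y \<ge> - w + 2 * ln (1 + c) - ln 3 - 1 / 1000000" using e' A by linarith
  have hi: "y \<le> - w + w * z / 2 + 2 * c - ln 3 + 1 / 1000000" using e' B C by linarith
  consider "r = 0" | "r = -1" | "r = -2" using r by linarith
  then show False
  proof cases
    case 1
    then have "w = 0" by (simp add: w_def)
    then have "of_int (-2) * ln 2 < y" "y < of_int (-2 + 1) * ln 2"
      using lo hi D c63 l2 l3 by auto
    from int_mult_ln_2_gap[OF this, of t] show False by (simp add: y_def)
  next
    case 2
    then have w1: "w = 1" by (simp add: w_def)
    \<comment> \<open>The critical case: \<open>- 1 - ln 3\<close> is less than 0.02 below
      \<open>- 3 * ln 2\<close>. The correction, about \<open>4 / k\<close>, lifts the value above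
      \<open>- 3 * ln 2\<close> for \<open>k = 127\<close> but not for \<open>k >= 255\<close>, so
      the two cases use different gaps.\<close>
    have "s \<ge> 7"
    proof (rule ccontr)
      assume "\<not> s \<ge> 7"
      then have "(2::int) ^ s \<le> 2 ^ 6" by (intro power_increasing) auto
      then show False using kr k 2 by simp
    qed
    show False
    proof (cases "s = 7")
      case True
      then have "k = 127" using kr 2 by simp
      then have c1: "c = 1 / 63" and z1: "z = 1 / 127" by (simp_all add: c_def z_def w1)
      have "c - c ^ 2 / 2 + c ^ 3 / 3 - c ^ 4 / 4 \<le> ln (1 + c)" by (rule ln_one_plus_Taylor_bounds(1)[OF c])
      then have "ln (1 + c) \<ge> 1 / 64" unfolding c1 by (simp add: power_divide)
      then have "of_int (-3) * ln 2 < y" "y < of_int (-3 + 1) * ln 2"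
        using lo hi l2 l3 by (auto simp: w1 c1 z1)
      from int_mult_ln_2_gap[OF this, of t] show False by (simp add: y_def)
    next
      case False
      then have "(2::int) ^ 8 \<le> 2 ^ s" using \<open>s \<ge> 7\<close> by (intro power_increasing) auto
      then have "k \<ge> 255" using kr 2 by simp
      then have "c \<le> 2 / 254" "z \<le> 1 / 255" unfolding c_def z_def w1
        by (auto intro!: divide_left_mono simp: frac_le)
      then have "of_int (-4) * ln 2 < y" "y < of_int (-4 + 1) * ln 2"
        using lo hi D l2 l3 by (auto simp: w1)
      from int_mult_ln_2_gap[OF this, of t] show False by (simp add: y_def)
    qed
  next
    case 3
    then have "w = 2" by (simp add: w_def)
    then have "of_int (-5) * ln 2 < y" "y < of_int (-5 + 1) * ln 2"
      using lo hi D c63 z64 l2 l3 by auto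
    from int_mult_ln_2_gap[OF this, of t] show False by (simp add: y_def)
  qed
qed

lemma lucas_neq_disc_large:
  assumes k: "k \<ge> 64" and disc: "d * (int k - 1)\<^sup>2 = disc_num k"
  shows "lucas k n \<noteq> d"
proof
  assume eq: "lucas k n = d"
  obtain s :: nat and r t :: int
    where kr: "int k = 2 ^ s + r" and s: "6 \<le> s" and r: "-2 \<le> r" "10 * r \<le> 21 * int s + 30"
    and err: "log_error k n = real k * ln (real k / 2 ^ s) - 2 * ln ((real k - 1) / 2 ^ s) - ln 3 - of_int t * ln 2"
    using lucas_eq_disc_dyadic[OF k disc eq] by blast
  have tiny: "\<bar>log_error k n\<bar> \<le> 1 / 1000000" using abs_log_error_tiny[OF k disc eq] by simp
  consider "r \<le> 0" | "r \<ge> 1" "s < 29" | "r \<ge> 1" "s \<ge> 29" by linarith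
  then show False
  proof cases
    case 1
    then show False using nonpos_offset_impossible[OF k kr r(1)] tiny unfolding err by blast
  next
    case 2
    have "real_of_int (int k) = real_of_int (2 ^ s + r)" using kr by (simp only:)
    then have k_real: "real k = 2 ^ s + of_int r" by simp
    have "real k / 2 ^ s = 1 + of_int r / 2 ^ s" "(real k - 1) / 2 ^ s = 1 + of_int (r - 1) / 2 ^ s"
      by (simp_all add: k_real field_simps)
    moreover have "separated s r" using s 2 r by (intro separated_range) auto
    ultimately show False using separated_imp[of s r t] 2 tiny unfolding err k_real by simp
  next
    case 3
    define r' where "r' = nat r"
    have "int k = int (2 ^ s + r')" using kr 3 by (simp add: r'_def)
    then have "k = 2 ^ s + r'" by (simp only: of_nat_eq_iff)
    moreover have "1 \<le> r'" "10 * r' \<le> 21 * s + 30" using r 3 by (auto simp: r'_def)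
    ultimately show False
      using no_close_power_near_dyadic[of s k r' t] 3(2) abs_log_error[OF k disc eq] unfolding err by blast
  qed
qed

theorem theorem1p1:
  shows "\<not> (\<exists>(n::int) (k::nat). n \<ge> 0 \<and> k \<ge> 2 \<and>
           gen_lucas k n = \<bar>discriminant (char_poly_g k)\<bar>)"
proof (intro notI, elim exE conjE)
  fix n :: int and k :: nat
  assume n: "n \<ge> 0" and k: "k \<ge> 2" and eq: "gen_lucas k n = \<bar>discriminant (char_poly_g k)\<bar>"
  have "lucas k (nat n) = \<bar>discriminant (char_poly_g k)\<bar>" using n eq by (simp add: lucas_def)
  moreover note abs_discriminant_char_poly_g[OF k]
  ultimately show False
    using lucas_neq_disc_small[OF k, of "\<bar>discriminant (char_poly_g k)\<bar>" "nat n"]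
      lucas_neq_disc_large[of k "\<bar>discriminant (char_poly_g k)\<bar>" "nat n"] by fastforce
qed

end
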